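(* Let $q\in\mathbb{C}$ with $\operatorname{Re} q>0$. Any function $G_r\in\mathcal{J}_r$ with $r\operatorname{Re} q>r_0$ can be extended to a $k$-quasiconformal automorphism of $\mathbb{C}$ with $k=k(r)=A(r\operatorname{Re} q)$.
   Context: $\mathbb{D}=\{z\in\mathbb{C}:|z|<1\}$. The function $A$ is defined by $A(x)=\dfrac{6x(1+x)}{(1+x)^3-3(5x-1)}$, and $r_0$ is the largest real root of the equation $A(x)=1$, namely $r_0=1+2\sqrt7\cos\left(\frac13\arctan\frac{3\sqrt{31}}{8}\right)\approx 5.92434$. A holomorphic function $f:\mathbb{D}\to\mathbb{C}$ is called a generator if for every $z\in\mathbb{D}$ the Cauchy problem $\frac{\partial u(t,z)}{\partial t}+f(u(t,z))=0$, $u(0,z)=z$, has a unique solution $u(t,z)\in\mathbb{D}$ defined for all $t\ge 0$. For a generator $f$ and $r>0$, it is known that $(\mathrm{Id}+rf)(\mathbb{D})\supset\mathbb{D}$ and that $G_r:=(\mathrm{Id}+rf)^{-1}$ is a well-defined holomorphic (univalent) self-mapping of $\mathbb{D}$; it is called the nonlinear resolvent of $f$. For fixed $q\in\mathbb{C}$ with $\operatorname{Re} q>0$ and $r>0$, $\mathcal{J}_r$ denotes the family of all resolvents $G_r=(\mathrm{Id}+rf)^{-1}$ of generators $f$ with $f(0)=0$ and $f'(0)=q$. For $0\le k<1$, a $k$-quasiconformal automorphism of $\mathbb{C}$ is a homeomorphism $g:\mathbb{C}\to\mathbb{C}$ in the Sobolev class $W^{1,2}_{\mathrm{loc}}$ with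 $|g_{\bar z}|\le k|g_z|$ almost everywhere. *)

theory Defs
  imports "HOL-Complex_Analysis.Complex_Analysis"
begin

abbreviation unit_disk :: "complex set" ("\<D>") where
  "\<D> \<equiv> ball 0 1"

definition A_bound :: "real \<Rightarrow> real" where
  "A_bound x = 6 * x * (1 + x) / ((1 + x) ^ 3 - 3 * (5 * x - 1))"

definition r0 :: real where
  "r0 = (GREATEST x. A_bound x = 1)"

lemma A_bound_eq_1_iff: "A_bound x = 1 \<longleftrightarrow> (x - 1) ^ 3 - 21 * (x - 1) = 16"
proof -
  define d where "d = (1 + x) ^ 3 - 3 * (5 * x - 1)"
  have *: "6 * x * (1 + x) = d \<longleftrightarrow> (x - 1) ^ 3 - 21 * (x - 1) = 16"
    unfolding d_def by (auto simp: power3_eq_cube algebra_simps)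
  have "d \<noteq> 0" if "6 * x * (1 + x) = d"
  proof
    assume "d = 0"
    with that have "x = 0 \<or> x = -1" by auto
    with \<open>d = 0\<close> show False by (auto simp: d_def)
  qed
  moreover have "6 * x * (1 + x) = d \<longrightarrow> A_bound x = 1" if "d \<noteq> 0"
    using that by (simp add: A_bound_def d_def)
  moreover have "d \<noteq> 0 \<and> 6 * x * (1 + x) = d" if "A_bound x = 1"
    using that unfolding A_bound_def d_def[symmetric] by (cases "d = 0") (auto simp: field_simps)
  ultimately show ?thesis using * by blast
qed

lemma r0_closed_form: "r0 = 1 + 2 * sqrt 7 * cos (1 / 3 * arctan (3 * sqrt 31 / 8))"
proof -
  define t where "t = 1 / 3 * arctan (3 * sqrt 31 / 8)"
  define y where "y = 2 * sqrt 7 * cos t"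
  have s7: "sqrt 7 ^ 3 = 7 * sqrt (7::real)" by (simp add: power3_eq_cube)
  have "cos (3 * t) = 8 / sqrt 343"
  proof -
    have "1 + (3 * sqrt 31 / 8)\<^sup>2 = (343::real) / 64"
      by (simp add: power_divide power_mult_distrib)
    then have "cos (3 * t) = 1 / sqrt (343 / 64)"
      by (simp add: t_def cos_arctan)
    also have "sqrt 64 = (8::real)" using real_sqrt_abs[of 8] by simp
    then have "1 / sqrt (343 / 64) = 8 / sqrt (343::real)"
      by (simp add: real_sqrt_divide)
    finally show ?thesis .
  qed
  moreover have "sqrt 343 = 7 * sqrt (7::real)"
    using real_sqrt_mult[of 49 7] real_sqrt_abs[of 7] by simp
  ultimately have c3: "4 * cos t ^ 3 - 3 * cos t = 8 / (7 * sqrt 7)"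
    by (simp add: cos_treble_cos)
  have "y ^ 3 - 21 * y = 14 * sqrt 7 * (4 * cos t ^ 3 - 3 * cos t)"
    by (simp add: y_def power_mult_distrib s7 algebra_simps)
  then have root: "y ^ 3 - 21 * y = 16" by (simp add: c3)
  have "0 \<le> t" "t \<le> pi / 6"
    using arctan_ubound[of "3 * sqrt 31 / 8"] by (simp_all add: t_def)
  then have "cos (pi / 6) \<le> cos t"
    by (intro cos_monotone_0_pi_le) auto
  then have "sqrt 3 / 2 \<le> cos t" by (simp add: cos_30)
  then have "2 * sqrt 7 * (sqrt 3 / 2) \<le> y"
    unfolding y_def by (intro mult_left_mono) auto
  then have y: "sqrt 21 \<le> y" using real_sqrt_mult[of 7 3] by simp
  then have y0: "0 < y" using real_sqrt_gt_zero[of 21] by linarith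
  have y2: "21 \<le> y\<^sup>2" using y y0 real_sqrt_le_iff[of 21 "y\<^sup>2"] by simp
  show ?thesis unfolding r0_def t_def[symmetric] y_def[symmetric]
  proof (rule Greatest_equality)
    show "A_bound (1 + y) = 1" using root by (simp add: A_bound_eq_1_iff)
  next
    fix x assume "A_bound x = 1"
    then have r: "(x - 1) ^ 3 - 21 * (x - 1) = 16" by (simp add: A_bound_eq_1_iff)
    show "x \<le> 1 + y"
    proof (rule ccontr)
      assume "\<not> x \<le> 1 + y"
      then have xy: "y < x - 1" by simp
      then have "21 < (x - 1)\<^sup>2"
        using y2 y0 power_strict_mono[of y "x - 1" 2] by linarith
      then have "y * (y\<^sup>2 - 21) < (x - 1) * ((x - 1)\<^sup>2 - 21)"
        using xy y0 y2 power_strict_mono[of y "x - 1" 2] by (intro mult_strict_mono') auto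
      then show False using r root
        by (simp add: power2_eq_square power3_eq_cube algebra_simps)
    qed
  qed
qed

definition is_trajectory :: "(complex \<Rightarrow> complex) \<Rightarrow> complex \<Rightarrow> (real \<Rightarrow> complex) \<Rightarrow> bool" where
  "is_trajectory f z u \<longleftrightarrow>
     u 0 = z \<and>
     (\<forall>t\<ge>0. u t \<in> \<D> \<and> (u has_vector_derivative - f (u t)) (at t within {0..}))"

text \<open>Trajectories are total functions on the reals, so uniqueness only concerns times
  \<open>t \<ge> 0\<close>.\<close>

definition generator :: "(complex \<Rightarrow> complex) \<Rightarrow> bool" where
  "generator f \<longleftrightarrow>
     f holomorphic_on \<D> \<and>
     (\<forall>z\<in>\<D>. (\<exists>u. is_trajectory f z u) \<and>
        (\<forall>u v. is_trajectory f z u \<and> is_trajectory f z v \<longrightarrow> (\<forall>t\<ge>0. u t = v t)))"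

text \<open>For \<open>w \<in> \<D>\<close>, \<open>nonlinear_resolvent r f w\<close> is the unique \<open>z \<in> \<D>\<close>
  with \<open>z + r f(z) = w\<close>; its values outside \<open>\<D>\<close> carry no meaning.\<close>

definition nonlinear_resolvent :: "real \<Rightarrow> (complex \<Rightarrow> complex) \<Rightarrow> complex \<Rightarrow> complex" where
  "nonlinear_resolvent r f = the_inv_into \<D> (\<lambda>z. z + of_real r * f z)"

definition resolvent_family :: "complex \<Rightarrow> real \<Rightarrow> (complex \<Rightarrow> complex) set" where
  "resolvent_family q r =
     {nonlinear_resolvent r f | f. generator f \<and> f 0 = 0 \<and> deriv f 0 = q}"

text \<open>Below, the plane is \<open>\<real>\<^sup>2\<close> with coordinate directions \<open>1\<close> and \<open>\<i>\<close>.\<close>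

primrec C_k :: "nat \<Rightarrow> (complex \<Rightarrow> real) \<Rightarrow> bool" where
  "C_k 0 \<phi> \<longleftrightarrow> continuous_on UNIV \<phi>"
| "C_k (Suc n) \<phi> \<longleftrightarrow>
     (\<forall>z. \<phi> differentiable (at z)) \<and>
     C_k n (\<lambda>z. frechet_derivative \<phi> (at z) 1) \<and>
     C_k n (\<lambda>z. frechet_derivative \<phi> (at z) \<i>)"

definition test_function :: "(complex \<Rightarrow> real) \<Rightarrow> bool" where
  "test_function \<phi> \<longleftrightarrow>
     (\<forall>n. C_k n \<phi>) \<and> (\<exists>K. compact K \<and> (\<forall>z. z \<notin> K \<longrightarrow> \<phi> z = 0))"

definition L2_loc :: "(complex \<Rightarrow> complex) \<Rightarrow> bool" where
  "L2_loc g \<longleftrightarrow>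
     g \<in> borel_measurable lebesgue \<and>
     (\<forall>K. compact K \<longrightarrow> set_integrable lebesgue K (\<lambda>z. (cmod (g z))\<^sup>2))"

definition weak_derivative ::
    "complex \<Rightarrow> (complex \<Rightarrow> complex) \<Rightarrow> (complex \<Rightarrow> complex) \<Rightarrow> bool" where
  "weak_derivative v g h \<longleftrightarrow>
     (\<forall>\<phi>. test_function \<phi> \<longrightarrow>
        (LINT z|lebesgue. frechet_derivative \<phi> (at z) v *\<^sub>R g z)
          = - (LINT z|lebesgue. \<phi> z *\<^sub>R h z))"

text \<open>\<open>W12_loc g gx gy\<close>: \<open>g\<close> lies in the Sobolev class
  \<open>W\<^sup>1\<^sup>,\<^sup>2\<close>-loc, with weak partial derivatives \<open>gx\<close> and \<open>gy\<close>
  (which \<open>g\<close> determines up to null sets).\<close>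

definition W12_loc ::
    "(complex \<Rightarrow> complex) \<Rightarrow> (complex \<Rightarrow> complex) \<Rightarrow> (complex \<Rightarrow> complex) \<Rightarrow> bool" where
  "W12_loc g gx gy \<longleftrightarrow>
     L2_loc g \<and> L2_loc gx \<and> L2_loc gy \<and> weak_derivative 1 g gx \<and> weak_derivative \<i> g gy"

text \<open>The two expressions in the dilatation inequality are the Wirtinger derivatives of
  \<open>g\<close> with respect to the conjugate of \<open>z\<close> and to \<open>z\<close>.\<close>

definition quasiconformal_automorphism :: "real \<Rightarrow> (complex \<Rightarrow> complex) \<Rightarrow> bool" where
  "quasiconformal_automorphism k g \<longleftrightarrow>
     0 \<le> k \<and> k < 1 \<and>
     (\<exists>h. homeomorphism UNIV UNIV g h) \<and>
     (\<exists>gx gy. W12_loc g gx gy \<and>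
        (AE z in lebesgue.
           cmod ((gx z + \<i> * gy z) / 2) \<le> k * cmod ((gx z - \<i> * gy z) / 2)))"

end

theory Submission
  imports Defs
begin

text \<open>
  Write a generator vanishing at the origin as \<open>f(z) = z p(z)\<close> and put \<open>P = r p\<close>,
  \<open>x = r Re q = Re P(0)\<close>, \<open>C = 1 + P(0)\<close>. The resolvent inverts
  \<open>F(z) = z + r f(z) = z (1 + P(z))\<close>. The extension works because \<open>F\<close> is close to the linear map
  \<open>C z\<close> on the small disk that contains all values of the resolvent.

  \<^item> The time-\<open>t\<close> flow maps of the generator are holomorphic self-maps of the disk that fix the origin
    (\<open>flow_map_differentiable\<close>). By the Schwarz lemma \<open>|u(t,z)|\<close> is at most \<open>|z|\<close>, and differentiating
    at \<open>t = 0\<close> gives \<open>Re p \<ge> 0\<close> (\<open>generator_inner_nonneg\<close>).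
  \<^item> Harnack's inequality for \<open>P\<close> shows that \<open>|F(z)| < 1\<close> forces \<open>|z| < 1/(x - 1)\<close>
    (\<open>solution_small\<close>), and the Schwarz--Pick lemma bounds \<open>F'(z) - C\<close> there by
    \<open>2x(2x - 3)/(x - 2)\<^sup>2\<close>. For \<open>x > r0\<close> this is at most \<open>k |C|\<close> with \<open>k = A(x) < 1\<close>
    (\<open>A_bound_estimates\<close>).
  \<^item> Hence increments of \<open>F\<close> differ from those of \<open>C z\<close> by at most the factor \<open>k\<close>. Read backwards,
    with the centre of an Apollonius disk as new linear coefficient \<open>c\<close>, this says that
    \<open>h(w) = G(w) - c w\<close> is Lipschitz on the disk with constant \<open>k |c|\<close>, with no loss in \<open>k\<close>
    (\<open>inverse_close_to_linear\<close>).
  \<^item> Extend \<open>h\<close> to the closed disk and then by reflection, \<open>g(w) = c w + h(1 / cnj w)\<close> for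
    \<open>|w| > 1\<close>. Reflecting the exterior into the disk does not increase distances, so \<open>g\<close> is a
    Lipschitz perturbation of \<open>c w\<close> with constant smaller than \<open>|c|\<close>, hence a bi-Lipschitz
    homeomorphism. It is conformal inside; outside, its Wirtinger derivatives are \<open>c\<close> and a number of
    modulus at most \<open>k |c|\<close> (\<open>quasiconformal_extension_of_near_linear\<close>).
  \<^item> A Lipschitz function that has directional derivatives off a null set has them as weak
    derivatives (\<open>lipschitz_weak_derivative\<close>), so \<open>g\<close> lies in the Sobolev class.
\<close>

section \<open>Weak derivatives of Lipschitz functions\<close>

lemma continuous_on_compact_bound:
  fixes f :: "'a::metric_space \<Rightarrow> 'b::real_normed_vector"
  assumes "compact K" "continuous_on K f"
  obtains B where "0 \<le> B" "\<And>z. z \<in> K \<Longrightarrow> norm (f z) \<le> B"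
proof -
  have "bounded (f ` K)"
    using assms by (intro compact_imp_bounded compact_continuous_image)
  then obtain B where "0 < B" "\<forall>y\<in>f ` K. norm y \<le> B" unfolding bounded_pos by blast
  then show ?thesis using that[of B] by auto
qed

lemma test_function_derivative:
  assumes "test_function \<phi>" and v: "v = 1 \<or> v = \<i>"
  obtains K M where "compact K" "\<And>z. z \<notin> K \<Longrightarrow> \<phi> z = 0"
    "\<And>z. z \<notin> K \<Longrightarrow> frechet_derivative \<phi> (at z) v = 0"
    "continuous_on UNIV (\<lambda>z. frechet_derivative \<phi> (at z) v)"
    "\<And>z. \<bar>frechet_derivative \<phi> (at z) v\<bar> \<le> M"
    "\<And>z. \<phi> differentiable (at z)"
proof -
  obtain K where K: "compact K" "\<And>z. z \<notin> K \<Longrightarrow> \<phi> z = 0"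
    using assms(1) unfolding test_function_def by blast
  have "C_k (Suc (Suc 0)) \<phi>"
    using assms(1) unfolding test_function_def by blast
  then have diff: "\<And>z. \<phi> differentiable (at z)"
    and "\<And>z. (\<lambda>z. frechet_derivative \<phi> (at z) v) differentiable (at z)"
    using v by auto
  then have cont: "continuous_on UNIV (\<lambda>z. frechet_derivative \<phi> (at z) v)"
    by (intro differentiable_imp_continuous_on)
      (auto simp: differentiable_on_def)
  have zero: "frechet_derivative \<phi> (at z) v = 0" if "z \<notin> K" for z
  proof -
    have "(\<phi> has_derivative (\<lambda>_. 0)) (at z)"
    proof (rule has_derivative_transform_within_open[of "\<lambda>_. 0" _ _ UNIV "- K"])
      show "open (- K)" using K(1) by (simp add: compact_imp_closed open_Compl)
    qed (use that K(2) in auto)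
    then show ?thesis by (simp add: frechet_derivative_at[symmetric])
  qed
  obtain B where B: "\<And>z. z \<in> K \<Longrightarrow> \<bar>frechet_derivative \<phi> (at z) v\<bar> \<le> B"
    by (rule continuous_on_compact_bound[OF K(1) continuous_on_subset[OF cont subset_UNIV]]) auto
  have "\<bar>frechet_derivative \<phi> (at z) v\<bar> \<le> max B 0" for z
    using B[of z] zero[of z] by (cases "z \<in> K") auto
  then show ?thesis using that K zero cont diff by blast
qed

lemma has_vector_derivative_difference_quotient:
  fixes g :: "real \<Rightarrow> 'a::real_normed_vector"
  assumes "(g has_vector_derivative d) (at 0)"
  shows "((\<lambda>t. (g t - g 0) /\<^sub>R t) \<longlongrightarrow> d) (at 0)"
proof -
  have "((\<lambda>t. norm (g t - g 0 - t *\<^sub>R d) / norm t) \<longlongrightarrow> 0) (at 0)"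
    using assms unfolding has_vector_derivative_def has_derivative_iff_norm by simp
  moreover have "\<forall>\<^sub>F t in at 0. norm (g t - g 0 - t *\<^sub>R d) / norm t = norm ((g t - g 0) /\<^sub>R t - d)"
  proof (rule eventually_at_filter[THEN iffD2], rule always_eventually, intro allI impI)
    fix t :: real assume t: "t \<noteq> 0"
    have "(g t - g 0) /\<^sub>R t - d = (g t - g 0 - t *\<^sub>R d) /\<^sub>R t"
      using t by (simp add: algebra_simps)
    then show "norm (g t - g 0 - t *\<^sub>R d) / norm t = norm ((g t - g 0) /\<^sub>R t - d)"
      by (simp add: divide_inverse_commute)
  qed
  ultimately have "((\<lambda>t. norm ((g t - g 0) /\<^sub>R t - d)) \<longlongrightarrow> 0) (at 0)"
    by (rule Lim_transform_eventually)
  then show ?thesis by (simp add: LIM_zero_iff tendsto_norm_zero_iff)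
qed

text \<open>Discrete integration by parts: a translation moves the difference quotient from the test
  function to \<open>g\<close>. The quotients of \<open>g\<close> are bounded by the Lipschitz constant, so both sides
  converge by dominated convergence, for which convergence almost everywhere suffices. Setting
  \<open>d\<close> to zero on the exceptional null set makes it a pointwise limit of Borel functions.\<close>

lemma lipschitz_weak_derivative:
  fixes g d :: "complex \<Rightarrow> complex"
  assumes lip: "L-lipschitz_on UNIV g" and v: "v = 1 \<or> v = \<i>"
    and N: "N \<in> null_sets lborel"
    and d: "\<And>z. z \<notin> N \<Longrightarrow> ((\<lambda>t. g (z + t *\<^sub>R v)) has_vector_derivative d z) (at 0)"
    and d0: "\<And>z. z \<in> N \<Longrightarrow> d z = 0"
  shows "d \<in> borel_measurable borel" and "\<And>z. cmod (d z) \<le> L" and "weak_derivative v g d"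
proof -
  define h :: "nat \<Rightarrow> real" where "h n = 1 / real (Suc n)" for n
  have h0: "h n > 0" for n by (simp add: h_def)
  have h1: "h n \<le> 1" for n by (simp add: h_def)
  have hlim: "h \<longlonglongrightarrow> 0" unfolding h_def by (rule LIMSEQ_Suc[OF lim_1_over_n])
  have nv: "cmod v = 1" using v by auto
  have L0: "L \<ge> 0" using lip lipschitz_on_nonneg by blast
  have lip': "cmod (g a - g b) \<le> L * cmod (a - b)" for a b
    using lipschitz_onD[OF lip, of a b] by (simp add: dist_norm)
  have contg: "continuous_on UNIV g" by (rule lipschitz_on_continuous_on[OF lip])
  then have gm[measurable]: "g \<in> borel_measurable borel" by (simp add: borel_measurable_continuous_onI)
  have Nm[measurable]: "N \<in> sets borel" using N by auto
  have quot: "(\<lambda>n. (g (z + s n *\<^sub>R v) - g z) /\<^sub>R s n) \<longlonglongrightarrow> d z"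
    if "z \<notin> N" "s \<longlonglongrightarrow> 0" "\<And>n. s n \<noteq> 0" for z s
  proof -
    have "((\<lambda>t. (g (z + t *\<^sub>R v) - g z) /\<^sub>R t) \<longlongrightarrow> d z) (at 0)"
      using has_vector_derivative_difference_quotient[OF d[OF that(1)]] by simp
    moreover have "filterlim s (at 0) sequentially"
      using that(2,3) by (simp add: filterlim_at)
    ultimately show ?thesis by (rule filterlim_compose)
  qed
  show dm[measurable]: "d \<in> borel_measurable borel"
  proof (rule borel_measurable_LIMSEQ_metric)
    fix n
    show "(\<lambda>z. indicator (- N) z *\<^sub>R ((g (z + h n *\<^sub>R v) - g z) /\<^sub>R h n)) \<in> borel_measurable borel"
      by measurable
  next
    fix z
    show "(\<lambda>n. indicator (- N) z *\<^sub>R ((g (z + h n *\<^sub>R v) - g z) /\<^sub>R h n)) \<longlonglongrightarrow> d z"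
    proof (cases "z \<in> N")
      case True then show ?thesis using d0 by simp
    next
      case False
      then show ?thesis using quot[OF False hlim] h0 by (simp add: less_imp_neq[THEN not_sym])
    qed
  qed
  have qb: "cmod ((g (z + s *\<^sub>R v) - g z) /\<^sub>R s) \<le> L" for z :: complex and s :: real
  proof (cases "s = 0")
    case True then show ?thesis using L0 by simp
  next
    case False
    have "cmod (g (z + s *\<^sub>R v) - g z) \<le> L * \<bar>s\<bar>"
      using lip'[of "z + s *\<^sub>R v" z] nv by simp
    then show ?thesis using False by (simp add: divide_simps)
  qed
  show db: "cmod (d z) \<le> L" for z
  proof (cases "z \<in> N")
    case True then show ?thesis using d0 L0 by simp
  next
    case False
    have "(\<lambda>n. cmod ((g (z + h n *\<^sub>R v) - g z) /\<^sub>R h n)) \<longlonglongrightarrow> cmod (d z)"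
      by (intro tendsto_norm quot[OF False hlim]) (use h0 in \<open>simp add: less_imp_neq[THEN not_sym]\<close>)
    then show ?thesis by (rule LIMSEQ_le_const2) (use qb in auto)
  qed
  show "weak_derivative v g d"
    unfolding weak_derivative_def
  proof (intro allI impI)
    fix \<phi> assume \<phi>: "test_function \<phi>"
    define D where "D z = frechet_derivative \<phi> (at z) v" for z
    obtain K M where K: "compact K" "\<And>z. z \<notin> K \<Longrightarrow> \<phi> z = 0"
      and D: "\<And>z. z \<notin> K \<Longrightarrow> D z = 0" "continuous_on UNIV D" "\<And>z. \<bar>D z\<bar> \<le> M"
      and diff: "\<And>z. \<phi> differentiable (at z)"
      unfolding D_def using test_function_derivative[OF \<phi> v] by metis
    have cont\<phi>: "continuous_on UNIV \<phi>"
      using diff by (intro differentiable_imp_continuous_on) (auto simp: differentiable_on_def)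
    have \<phi>m[measurable]: "\<phi> \<in> borel_measurable borel" and Dm[measurable]: "D \<in> borel_measurable borel"
      using cont\<phi> D(2) by (simp_all add: borel_measurable_continuous_onI)
    have line: "((\<lambda>t. \<phi> (z + t *\<^sub>R v)) has_vector_derivative D (z + t *\<^sub>R v)) (at t)" for z t
    proof -
      have "((\<lambda>t. z + t *\<^sub>R v) has_vector_derivative v) (at t)"
        by (auto intro!: derivative_eq_intros)
      moreover have "(\<phi> has_derivative frechet_derivative \<phi> (at (z + t *\<^sub>R v))) (at (z + t *\<^sub>R v) within range (\<lambda>t. z + t *\<^sub>R v))"
        using diff frechet_derivative_works has_derivative_at_withinI by blast
      ultimately show ?thesis
        using vector_derivative_diff_chain_within unfolding D_def o_def by fastforce
    qed
    have lip\<phi>: "\<bar>\<phi> (z + t *\<^sub>R v) - \<phi> z\<bar> \<le> M * \<bar>t\<bar>" for z t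
    proof -
      have "norm (\<phi> (z + t *\<^sub>R v) - \<phi> (z + 0 *\<^sub>R v)) \<le> M * norm (t - 0)"
      proof (rule field_differentiable_bound[of UNIV])
        show "((\<lambda>t. \<phi> (z + t *\<^sub>R v)) has_field_derivative D (z + t *\<^sub>R v)) (at t within UNIV)" for t
          using line by (simp add: has_real_derivative_iff_has_vector_derivative)
      qed (use D(3) in auto)
      then show ?thesis by simp
    qed
    have M0: "M \<ge> 0" using D(3)[of 0] by linarith
    \<comment> \<open>Every difference quotient with step at most one is supported in this neighbourhood of the support.\<close>
    define K1 where "K1 = (\<lambda>(a,b). a + b) ` (K \<times> cball 0 1 :: (complex \<times> complex) set)"
    have K1: "compact K1" unfolding K1_def
      by (intro compact_continuous_image compact_Times K(1) compact_cball)
        (auto intro!: continuous_intros simp: case_prod_unfold)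
    have inK1: "z \<in> K1" if "z \<in> K \<or> z + h n *\<^sub>R v \<in> K" for z n
    proof -
      have "(\<lambda>(a,b). a + b) (z, 0) = z" "(\<lambda>(a,b). a + b) (z + h n *\<^sub>R v, - (h n *\<^sub>R v)) = z" by auto
      moreover have "- (h n *\<^sub>R v) \<in> cball 0 1" using nv h0[of n] h1[of n] by simp
      ultimately show ?thesis using that unfolding K1_def
        by (metis (no_types, lifting) SigmaI centre_in_cball imageI zero_le_one)
    qed
    obtain B where B: "\<And>z. z \<in> K1 \<Longrightarrow> cmod (g z) \<le> B"
      using continuous_on_compact_bound[OF K1 continuous_on_subset[OF contg subset_UNIV]] by blast
    obtain B' where B': "\<And>z. z \<in> K \<Longrightarrow> \<bar>\<phi> z\<bar> \<le> B'"
      by (rule continuous_on_compact_bound[OF K(1) continuous_on_subset[OF cont\<phi> subset_UNIV]]) auto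
    have int1: "integrable lborel (\<lambda>z. indicator S z * c)" if "compact S" for S :: "complex set" and c :: real
      using borel_integrable_compact[OF that, of "\<lambda>_. c"] by simp
    define I where "I n z = ((\<phi> (z + h n *\<^sub>R v) - \<phi> z) / h n) *\<^sub>R g z" for n z
    define J where "J n z = \<phi> z *\<^sub>R ((g (z + (- h n) *\<^sub>R v) - g z) /\<^sub>R (- h n))" for n z
    have limI: "(\<lambda>n. LINT z|lborel. I n z) \<longlonglongrightarrow> (LINT z|lborel. D z *\<^sub>R g z)"
    proof (rule integral_dominated_convergence[where w="\<lambda>z. indicator K1 z * (M * B)"])
      show "AE z in lborel. (\<lambda>n. I n z) \<longlonglongrightarrow> D z *\<^sub>R g z"
      proof (rule AE_I2)
        fix z
        have "((\<lambda>t. (\<phi> (z + t *\<^sub>R v) - \<phi> z) /\<^sub>R t) \<longlongrightarrow> D z) (at 0)"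
          using has_vector_derivative_difference_quotient[OF line[of z 0, simplified]] by simp
        moreover have "filterlim h (at 0) sequentially"
          using hlim h0 by (simp add: filterlim_at less_imp_neq[THEN not_sym])
        ultimately have "(\<lambda>n. (\<phi> (z + h n *\<^sub>R v) - \<phi> z) /\<^sub>R h n) \<longlonglongrightarrow> D z" by (rule filterlim_compose)
        then show "(\<lambda>n. I n z) \<longlonglongrightarrow> D z *\<^sub>R g z" unfolding I_def
          by (intro tendsto_intros) (simp add: divide_inverse_commute)
      qed
      show "AE z in lborel. cmod (I n z) \<le> indicator K1 z * (M * B)" for n
      proof (rule AE_I2)
        fix z
        show "cmod (I n z) \<le> indicator K1 z * (M * B)"
        proof (cases "z \<in> K1")
          case True
          have "\<bar>(\<phi> (z + h n *\<^sub>R v) - \<phi> z) / h n\<bar> \<le> M"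
            using lip\<phi>[of z "h n"] h0[of n] by (simp add: divide_simps abs_mult)
          then have "\<bar>(\<phi> (z + h n *\<^sub>R v) - \<phi> z) / h n\<bar> * cmod (g z) \<le> M * B"
            using B[OF True] M0 by (intro mult_mono) auto
          then show ?thesis unfolding I_def norm_scaleR using True by simp
        next
          case False
          then have "\<phi> z = 0" "\<phi> (z + h n *\<^sub>R v) = 0" using inK1 K(2) by blast+
          then show ?thesis by (simp add: I_def False)
        qed
      qed
    qed (use int1[OF K1] in \<open>auto simp: I_def\<close>)
    have limJ: "(\<lambda>n. LINT z|lborel. J n z) \<longlonglongrightarrow> (LINT z|lborel. \<phi> z *\<^sub>R d z)"
    proof (rule integral_dominated_convergence[where w="\<lambda>z. indicator K z * (B' * L)"])
      have "AE z in lborel. z \<notin> N" using N by (rule AE_not_in)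
      then show "AE z in lborel. (\<lambda>n. J n z) \<longlonglongrightarrow> \<phi> z *\<^sub>R d z"
      proof (rule AE_mp, intro AE_I2 impI)
        fix z assume "z \<notin> N"
        then have "(\<lambda>n. (g (z + (- h n) *\<^sub>R v) - g z) /\<^sub>R (- h n)) \<longlonglongrightarrow> d z"
          by (rule quot) (use tendsto_minus[OF hlim] h0 in \<open>simp_all add: less_imp_neq[THEN not_sym]\<close>)
        then show "(\<lambda>n. J n z) \<longlonglongrightarrow> \<phi> z *\<^sub>R d z" unfolding J_def by (intro tendsto_intros)
      qed
      show "AE z in lborel. cmod (J n z) \<le> indicator K z * (B' * L)" for n
      proof (rule AE_I2)
        fix z
        show "cmod (J n z) \<le> indicator K z * (B' * L)"
        proof (cases "z \<in> K")
          case True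
          have "cmod (J n z) = \<bar>\<phi> z\<bar> * cmod ((g (z + (- h n) *\<^sub>R v) - g z) /\<^sub>R (- h n))"
            unfolding J_def by (rule norm_scaleR)
          also have "\<dots> \<le> B' * L" using B'[OF True] qb[of "- h n" z]
            by (intro mult_mono) auto
          finally show ?thesis using True by simp
        next
          case False then show ?thesis using K(2) by (simp add: J_def)
        qed
      qed
    qed (use int1[OF K(1)] in \<open>auto simp: J_def\<close>)
    have supp: "integrable lborel (\<lambda>z. \<phi> (z + a) *\<^sub>R u z)" if u: "continuous_on UNIV u" for a and u :: "complex \<Rightarrow> complex"
    proof -
      have "compact ((\<lambda>z. z - a) ` K)" using K(1)
        by (intro compact_continuous_image continuous_intros)
      moreover have "continuous_on UNIV (\<lambda>z. \<phi> (z + a) *\<^sub>R u z)"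
        by (intro continuous_intros u continuous_on_compose2[OF cont\<phi>]) auto
      ultimately have "integrable lborel (\<lambda>z. indicator ((\<lambda>z. z - a) ` K) z *\<^sub>R (\<phi> (z + a) *\<^sub>R u z))"
        by (intro borel_integrable_compact) (auto intro: continuous_on_subset)
      moreover have "indicator ((\<lambda>z. z - a) ` K) z *\<^sub>R (\<phi> (z + a) *\<^sub>R u z) = \<phi> (z + a) *\<^sub>R u z" for z
        using K(2)[of "z + a"] by (auto simp: indicator_def image_iff) (metis add_diff_cancel_right')
      ultimately show ?thesis by (simp only:)
    qed
    have IJ: "(LINT z|lborel. I n z) = - (LINT z|lborel. J n z)" for n
    proof -
      define a where "a = h n *\<^sub>R v"
      have sh: "continuous_on UNIV (\<lambda>z. g (z - a))"
        by (intro continuous_on_compose2[OF contg] continuous_intros) auto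
      \<comment> \<open>Translation by the step moves the difference quotient from the test function to the other factor.\<close>
      have tr: "(LINT z|lborel. \<phi> (z + a) *\<^sub>R g z) = (LINT z|lborel. \<phi> z *\<^sub>R g (z - a))"
      proof -
        have "(LINT z|lborel. \<phi> z *\<^sub>R g (z - a)) = (LINT z|distr lborel borel ((+) a). \<phi> z *\<^sub>R g (z - a))"
          by (simp add: lborel_distr_plus)
        also have "\<dots> = (LINT z|lborel. \<phi> (a + z) *\<^sub>R g (a + z - a))"
          by (rule integral_distr) measurable
        finally show ?thesis by (simp add: add.commute)
      qed
      have "(LINT z|lborel. I n z) = (LINT z|lborel. (1 / h n) *\<^sub>R (\<phi> (z + a) *\<^sub>R g z - \<phi> z *\<^sub>R g z))"
        by (intro Bochner_Integration.integral_cong) (auto simp: I_def a_def algebra_simps divide_inverse)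
      also have "\<dots> = (1 / h n) *\<^sub>R ((LINT z|lborel. \<phi> (z + a) *\<^sub>R g z) - (LINT z|lborel. \<phi> z *\<^sub>R g z))"
        using supp[OF contg, of a] supp[OF contg, of 0] by simp
      also have "\<dots> = (1 / h n) *\<^sub>R ((LINT z|lborel. \<phi> z *\<^sub>R g (z - a)) - (LINT z|lborel. \<phi> z *\<^sub>R g z))"
        by (simp only: tr)
      also have "\<dots> = (LINT z|lborel. (1 / h n) *\<^sub>R (\<phi> z *\<^sub>R g (z - a) - \<phi> z *\<^sub>R g z))"
        using supp[OF contg, of 0] supp[OF sh, of 0] by simp
      also have "\<dots> = (LINT z|lborel. - J n z)"
        by (intro Bochner_Integration.integral_cong) (auto simp: J_def a_def algebra_simps divide_inverse)
      finally show ?thesis by simp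
    qed
    have "(\<lambda>n. LINT z|lborel. I n z) \<longlonglongrightarrow> - (LINT z|lborel. \<phi> z *\<^sub>R d z)"
      unfolding IJ by (intro tendsto_intros limJ)
    with limI have "(LINT z|lborel. D z *\<^sub>R g z) = - (LINT z|lborel. \<phi> z *\<^sub>R d z)"
      by (rule LIMSEQ_unique)
    then show "(LINT z|lebesgue. frechet_derivative \<phi> (at z) v *\<^sub>R g z) = - (LINT z|lebesgue. \<phi> z *\<^sub>R d z)"
      by (subst (1 2) integral_completion) (auto simp: D_def[symmetric])
  qed
qed

lemma L2_loc_borel:
  assumes [measurable]: "g \<in> borel_measurable borel"
    and "\<And>K. compact K \<Longrightarrow> \<exists>B. \<forall>z\<in>K. cmod (g z) \<le> B"
  shows "L2_loc g"
  unfolding L2_loc_def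
proof (intro conjI allI impI)
  show "g \<in> borel_measurable lebesgue" using assms(1) by (simp add: measurable_completion)
  fix K :: "complex set" assume K: "compact K"
  then obtain B where B: "\<forall>z\<in>K. cmod (g z) \<le> B" using assms(2) by blast
  show "set_integrable lebesgue K (\<lambda>z. (cmod (g z))\<^sup>2)"
    unfolding set_integrable_def
  proof (rule integrableI_bounded_set_indicator)
    show "K \<in> sets lebesgue" using K by (simp add: lmeasurable_compact fmeasurableD)
    show "(\<lambda>z. (cmod (g z))\<^sup>2) \<in> borel_measurable lebesgue"
      by (rule measurable_completion) simp
    show "emeasure lebesgue K < \<infinity>"
      using lmeasurable_compact[OF K] unfolding fmeasurable_def by auto
    show "AE x in lebesgue. x \<in> K \<longrightarrow> norm ((cmod (g x))\<^sup>2) \<le> B\<^sup>2"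
      using B by (auto intro!: AE_I2 power_mono)
  qed
qed

section \<open>Generators and their flow\<close>

text \<open>Gronwall's inequality in differential form: \<open>exp(-2 L t) |D(t)|\<^sup>2\<close> is nonincreasing.
  Derivatives are required only in the open interval, so that trajectories, differentiable at time zero
  from one side only, are covered.\<close>

lemma norm_le_exp_of_derivative_bound:
  fixes D D' :: "real \<Rightarrow> 'a::real_inner"
  assumes T: "0 \<le> T" and cont: "continuous_on {0..T} D"
    and D: "\<And>t. 0 < t \<Longrightarrow> t < T \<Longrightarrow> (D has_vector_derivative D' t) (at t)"
    and le: "\<And>t. 0 < t \<Longrightarrow> t < T \<Longrightarrow> norm (D' t) \<le> L * norm (D t)"
  shows "norm (D T) \<le> exp (L * T) * norm (D 0)"
proof -
  define \<psi> where "\<psi> t = exp (- (2 * L) * t) * (D t \<bullet> D t)" for t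
  have "\<psi> T \<le> \<psi> 0"
  proof (rule DERIV_nonpos_imp_decreasing_open[OF T])
    fix t assume t: "0 < t" "t < T"
    have DD: "((\<lambda>t. D t \<bullet> D t) has_vector_derivative (D t \<bullet> D' t + D' t \<bullet> D t)) (at t)"
      using bounded_bilinear.has_vector_derivative[OF bounded_bilinear_inner D[OF t] D[OF t]] .
    have "((\<lambda>t. D t \<bullet> D t) has_real_derivative (2 * (D t \<bullet> D' t))) (at t)"
      using DD by (simp add: has_real_derivative_iff_has_vector_derivative inner_commute)
    then have "(\<psi> has_real_derivative
        exp (- (2 * L) * t) * (2 * (D t \<bullet> D' t)) + exp (- (2 * L) * t) * (- (2 * L)) * (D t \<bullet> D t)) (at t)"
      unfolding \<psi>_def by (auto intro!: derivative_eq_intros)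
    moreover have "D t \<bullet> D' t \<le> L * (D t \<bullet> D t)"
    proof -
      have "D t \<bullet> D' t \<le> norm (D t) * norm (D' t)" by (rule norm_cauchy_schwarz)
      also have "\<dots> \<le> norm (D t) * (L * norm (D t))" using le[OF t] by (intro mult_left_mono) auto
      finally show ?thesis by (simp add: dot_square_norm power2_eq_square mult.left_commute)
    qed
    then have "exp (- (2 * L) * t) * (2 * (D t \<bullet> D' t)) + exp (- (2 * L) * t) * (- (2 * L)) * (D t \<bullet> D t)
        = exp (- (2 * L) * t) * 2 * (D t \<bullet> D' t - L * (D t \<bullet> D t)) \<and> D t \<bullet> D' t - L * (D t \<bullet> D t) \<le> 0"
      by (simp add: algebra_simps)
    ultimately show "\<exists>y. (\<psi> has_real_derivative y) (at t) \<and> y \<le> 0"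
      by (metis (no_types, opaque_lifting) exp_ge_zero mult_nonneg_nonpos mult_nonneg_nonneg zero_le_numeral)
  next
    show "continuous_on {0..T} \<psi>" unfolding \<psi>_def by (intro continuous_intros cont)
  qed
  then have "exp (- (2 * L) * T) * (norm (D T))\<^sup>2 \<le> (norm (D 0))\<^sup>2"
    by (simp add: \<psi>_def dot_square_norm)
  then have "exp (2 * L * T) * (exp (- (2 * L) * T) * (norm (D T))\<^sup>2) \<le> exp (2 * L * T) * (norm (D 0))\<^sup>2"
    by (intro mult_left_mono) auto
  moreover have "exp (2 * L * T) * (exp (- (2 * L) * T) * (norm (D T))\<^sup>2) = (norm (D T))\<^sup>2"
    by (simp add: mult.assoc[symmetric] exp_add[symmetric] del: mult_cancel_right1 mult_eq_self_implies_10)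
  moreover have "exp (2 * L * T) * (norm (D 0))\<^sup>2 = (exp (L * T) * norm (D 0))\<^sup>2"
    by (simp add: power_mult_distrib exp_double[symmetric] mult.assoc)
  ultimately have "(norm (D T))\<^sup>2 \<le> (exp (L * T) * norm (D 0))\<^sup>2" by (simp only:)
  then show ?thesis by (rule power2_le_imp_le) auto
qed

text \<open>On a smaller concentric disk the first two derivatives are bounded, which gives first- and
  second-order Taylor bounds with uniform constants.\<close>

lemma holomorphic_on_disk_taylor_bounds:
  fixes \<rho> :: real
  assumes f: "f holomorphic_on \<D>" and \<rho>: "\<rho> < 1"
  obtains L M where "0 \<le> L" "0 \<le> M"
    "\<And>a b. \<lbrakk>cmod a \<le> \<rho>; cmod b \<le> \<rho>\<rbrakk> \<Longrightarrow> cmod (f b - f a) \<le> L * cmod (b - a)"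
    "\<And>a b. \<lbrakk>cmod a \<le> \<rho>; cmod b \<le> \<rho>\<rbrakk> \<Longrightarrow> cmod (f b - f a - deriv f a * (b - a)) \<le> M * (cmod (b - a))\<^sup>2"
proof -
  let ?B = "cball (0::complex) \<rho>"
  have sub: "?B \<subseteq> \<D>" using \<rho> by auto
  have f1: "deriv f holomorphic_on \<D>" and f2: "deriv (deriv f) holomorphic_on \<D>"
    using f by (auto intro!: holomorphic_deriv)
  have cont: "continuous_on ?B h" if "h holomorphic_on \<D>" for h
    using holomorphic_on_imp_continuous_on[OF that] sub by (rule continuous_on_subset)
  obtain L where L: "0 \<le> L" "\<And>z. z \<in> ?B \<Longrightarrow> cmod (deriv f z) \<le> L"
    using continuous_on_compact_bound[OF compact_cball cont[OF f1]] by blast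
  obtain M where M: "0 \<le> M" "\<And>z. z \<in> ?B \<Longrightarrow> cmod (deriv (deriv f) z) \<le> M"
    using continuous_on_compact_bound[OF compact_cball cont[OF f2]] by blast
  have d1: "(f has_field_derivative deriv f z) (at z within S)" if "z \<in> ?B" for z S
    by (rule holomorphic_derivI[OF f open_ball subsetD[OF sub that]])
  have d2: "(deriv f has_field_derivative deriv (deriv f) z) (at z within S)" if "z \<in> ?B" for z S
    by (rule holomorphic_derivI[OF f1 open_ball subsetD[OF sub that]])
  show ?thesis
  proof (rule that[OF L(1) M(1)])
    fix a b assume "cmod a \<le> \<rho>" "cmod b \<le> \<rho>"
    then have ab: "a \<in> ?B" "b \<in> ?B" by auto
    show "cmod (f b - f a) \<le> L * cmod (b - a)"
      by (rule field_differentiable_bound[of ?B f "deriv f"]) (use d1 L(2) ab in auto)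
    have seg: "closed_segment a b \<subseteq> ?B" using ab by (intro closed_segment_subset convex_cball)
    have "cmod ((f b - deriv f a * b) - (f a - deriv f a * a)) \<le> (M * cmod (b - a)) * cmod (b - a)"
    proof (rule field_differentiable_bound[of "closed_segment a b"])
      fix z assume z: "z \<in> closed_segment a b"
      then have zB: "z \<in> ?B" by (rule subsetD[OF seg])
      show "((\<lambda>z. f z - deriv f a * z) has_field_derivative deriv f z - deriv f a) (at z within closed_segment a b)"
        by (intro DERIV_diff d1[OF zB] DERIV_cmult_Id)
      have "cmod (deriv f z - deriv f a) \<le> M * cmod (z - a)"
        by (rule field_differentiable_bound[of ?B "deriv f" "deriv (deriv f)"]) (use d2 M(2) ab zB in auto)
      also have "\<dots> \<le> M * cmod (b - a)"
        using segment_bound1[OF z] M(1) by (intro mult_left_mono) auto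
      finally show "cmod (deriv f z - deriv f a) \<le> M * cmod (b - a)" .
    qed auto
    then show "cmod (f b - f a - deriv f a * (b - a)) \<le> M * (cmod (b - a))\<^sup>2"
      by (simp add: algebra_simps power2_eq_square)
  qed
qed

lemma trajectory_continuous:
  assumes "is_trajectory f z u" shows "continuous_on {0..T} u"
proof -
  have "continuous_on {0..} u"
    using assms unfolding is_trajectory_def
    by (auto simp: continuous_on_eq_continuous_within intro: has_vector_derivative_continuous)
  then show ?thesis by (rule continuous_on_subset) auto
qed

lemma trajectory_derivative:
  assumes "is_trajectory f z u" "0 < t"
  shows "(u has_vector_derivative - f (u t)) (at t)"
proof -
  have "(u has_vector_derivative - f (u t)) (at t within {0..})"
    using assms unfolding is_trajectory_def by auto
  then have "(u has_vector_derivative - f (u t)) (at t within {0<..})"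
    by (rule has_vector_derivative_within_subset) auto
  then show ?thesis using assms(2) by (simp add: at_within_open[of t "{0<..}"])
qed

text \<open>The reference trajectory stays in a compact subdisk up to time \<open>T\<close>, and a slightly larger
  subdisk provides Lipschitz and Taylor constants. Gronwall's inequality controls another trajectory as
  long as it remains in the tube of radius \<open>\<epsilon>\<close>; at a first exit time the same inequality would
  already keep the distance below \<open>\<epsilon>\<close>, so for \<open>z\<close> near \<open>z0\<close> there is no exit.\<close>

lemma trajectories_stay_close:
  assumes f: "f holomorphic_on \<D>" and u0: "is_trajectory f z0 u0" and T: "0 < T"
  obtains \<delta> E M where "0 < \<delta>" "0 \<le> E" "0 \<le> M"
    "\<And>z u t. \<lbrakk>is_trajectory f z u; cmod (z - z0) < \<delta>; 0 \<le> t; t \<le> T\<rbrakk> \<Longrightarrow>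
       cmod (u t - u0 t) \<le> E * cmod (z - z0) \<and>
       cmod (f (u t) - f (u0 t) - deriv f (u0 t) * (u t - u0 t)) \<le> M * (cmod (u t - u0 t))\<^sup>2"
proof -
  have "\<exists>s\<in>{0..T}. \<forall>t\<in>{0..T}. cmod (u0 t) \<le> cmod (u0 s)"
    using T by (intro continuous_attains_sup continuous_intros trajectory_continuous[OF u0]) auto
  then obtain s where s: "s \<in> {0..T}" and s': "\<And>t. t \<in> {0..T} \<Longrightarrow> cmod (u0 t) \<le> cmod (u0 s)" by blast
  define \<rho>1 where "\<rho>1 = cmod (u0 s)"
  have "\<rho>1 < 1" using u0 s unfolding is_trajectory_def \<rho>1_def by auto
  define \<epsilon> where "\<epsilon> = (1 - \<rho>1) / 2"
  have \<epsilon>: "0 < \<epsilon>" "\<rho>1 + \<epsilon> < 1" using \<open>\<rho>1 < 1\<close> by (auto simp: \<epsilon>_def field_simps)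
  obtain L M where L: "0 \<le> L" and M: "0 \<le> M"
    and fL: "\<And>a b. \<lbrakk>cmod a \<le> \<rho>1 + \<epsilon>; cmod b \<le> \<rho>1 + \<epsilon>\<rbrakk> \<Longrightarrow> cmod (f b - f a) \<le> L * cmod (b - a)"
    and fM: "\<And>a b. \<lbrakk>cmod a \<le> \<rho>1 + \<epsilon>; cmod b \<le> \<rho>1 + \<epsilon>\<rbrakk> \<Longrightarrow>
      cmod (f b - f a - deriv f a * (b - a)) \<le> M * (cmod (b - a))\<^sup>2"
    using holomorphic_on_disk_taylor_bounds[OF f \<epsilon>(2)] by metis
  define E where "E = exp (L * T)"
  have E: "E > 0" by (simp add: E_def)
  define \<delta> where "\<delta> = \<epsilon> / E"
  have \<delta>: "\<delta> > 0" using \<epsilon> E by (simp add: \<delta>_def)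
  show ?thesis
  proof (rule that[OF \<delta> less_imp_le[OF E] M])
    fix z u t
    assume u: "is_trajectory f z u" and z: "cmod (z - z0) < \<delta>" and t: "0 \<le> t" "t \<le> T"
    have b0: "cmod (u0 t) \<le> \<rho>1" if "t \<in> {0..T}" for t
      using s'[OF that] by (simp add: \<rho>1_def)
    have cont: "continuous_on {0..S} (\<lambda>t. u t - u0 t)" for S
      by (intro continuous_intros trajectory_continuous[OF u] trajectory_continuous[OF u0])
    have growth: "cmod (u S - u0 S) \<le> E * cmod (z - z0)"
      if S: "0 \<le> S" "S \<le> T" and close: "\<And>t. 0 < t \<Longrightarrow> t < S \<Longrightarrow> cmod (u t - u0 t) < \<epsilon>" for S
    proof -
      have "cmod (u S - u0 S) \<le> exp (L * S) * cmod (u 0 - u0 0)"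
      proof (rule norm_le_exp_of_derivative_bound[OF S(1) cont])
        fix t assume t: "0 < t" "t < S"
        show "((\<lambda>t. u t - u0 t) has_vector_derivative - (f (u t) - f (u0 t))) (at t)"
          using trajectory_derivative[OF u t(1)] trajectory_derivative[OF u0 t(1)]
          by (auto intro!: derivative_eq_intros)
        have "cmod (u0 t) \<le> \<rho>1" using b0 t S by simp
        moreover have "cmod (u t) \<le> cmod (u0 t) + cmod (u t - u0 t)" by (metis norm_triangle_sub)
        ultimately have "cmod (f (u t) - f (u0 t)) \<le> L * cmod (u t - u0 t)"
          using close[OF t] \<epsilon>(1) by (intro fL) auto
        then show "cmod (- (f (u t) - f (u0 t))) \<le> L * cmod (u t - u0 t)" by (simp only: norm_minus_cancel)
      qed
      also have "\<dots> \<le> E * cmod (z - z0)"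
        using S L u u0 unfolding E_def is_trajectory_def by (intro mult_mono) (auto intro: mult_left_mono)
      finally show ?thesis .
    qed
    have less: "E * cmod (z - z0) < \<epsilon>" using z E by (simp add: \<delta>_def field_simps)
    have tube: "cmod (u t - u0 t) < \<epsilon>" if t: "t \<in> {0..T}" for t
    proof (rule ccontr)
      assume "\<not> cmod (u t - u0 t) < \<epsilon>"
      let ?S = "{t \<in> {0..T}. \<epsilon> \<le> cmod (u t - u0 t)}"
      have "closed ?S"
        by (intro continuous_closed_preimage_constant continuous_on_closed_Collect_le continuous_intros cont closed_atLeastAtMost)
      moreover have "bounded ?S" by (rule bounded_subset[of "{0..T}"]) auto
      ultimately have "compact ?S" by (simp only: compact_eq_bounded_closed)
      moreover have "?S \<noteq> {}" using t \<open>\<not> cmod (u t - u0 t) < \<epsilon>\<close> by auto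
      ultimately obtain \<tau> where \<tau>: "\<tau> \<in> ?S" "\<And>t. t \<in> ?S \<Longrightarrow> \<tau> \<le> t"
        using compact_attains_inf[of ?S] by meson
      have "cmod (u \<tau> - u0 \<tau>) \<le> E * cmod (z - z0)"
      proof (rule growth)
        fix t assume "0 < t" "t < \<tau>"
        then have "t \<notin> ?S" using \<tau>(2)[of t] by linarith
        then show "cmod (u t - u0 t) < \<epsilon>" using \<open>0 < t\<close> \<open>t < \<tau>\<close> \<tau>(1) by auto
      qed (use \<tau>(1) in auto)
      then show False using less \<tau>(1) by auto
    qed
    have "cmod (u t - u0 t) \<le> E * cmod (z - z0)" by (rule growth) (use t tube in auto)
    moreover have "cmod (f (u t) - f (u0 t) - deriv f (u0 t) * (u t - u0 t)) \<le> M * (cmod (u t - u0 t))\<^sup>2"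
    proof (rule fM)
      show "cmod (u0 t) \<le> \<rho>1 + \<epsilon>" using b0[of t] t \<epsilon> by auto
      have "cmod (u t) \<le> cmod (u0 t) + cmod (u t - u0 t)" by (metis norm_triangle_sub)
      then show "cmod (u t) \<le> \<rho>1 + \<epsilon>" using b0[of t] tube[of t] t by auto
    qed
    ultimately show "cmod (u t - u0 t) \<le> E * cmod (z - z0) \<and>
       cmod (f (u t) - f (u0 t) - deriv f (u0 t) * (u t - u0 t)) \<le> M * (cmod (u t - u0 t))\<^sup>2" ..
  qed
qed

text \<open>The difference of two trajectories satisfies the linearised equation up to a quadratic error.
  With \<open>A(t)\<close> the integral of \<open>f'\<close> along the reference trajectory, multiplying the difference by
  \<open>exp(A(t))\<close> removes the linear part. What remains changes by \<open>O(|z - z0|\<^sup>2)\<close> only, so the complex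
  derivative of the flow map exists and equals \<open>exp(-A(T))\<close>.\<close>

lemma flow_map_differentiable:
  assumes f: "f holomorphic_on \<D>" and traj: "\<And>z. z \<in> \<D> \<Longrightarrow> is_trajectory f z (u z)"
    and T: "0 < T" and z0: "z0 \<in> \<D>"
  shows "(\<lambda>z. u z T) field_differentiable (at z0)"
proof -
  define u0 where "u0 = u z0"
  have u0: "is_trajectory f z0 u0" using traj z0 by (simp add: u0_def)
  obtain \<delta> E M where \<delta>: "0 < \<delta>" and E: "0 \<le> E" and M: "0 \<le> M"
    and close: "\<And>z u t. \<lbrakk>is_trajectory f z u; cmod (z - z0) < \<delta>; 0 \<le> t; t \<le> T\<rbrakk> \<Longrightarrow>
       cmod (u t - u0 t) \<le> E * cmod (z - z0) \<and>
       cmod (f (u t) - f (u0 t) - deriv f (u0 t) * (u t - u0 t)) \<le> M * (cmod (u t - u0 t))\<^sup>2"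
    using trajectories_stay_close[OF f u0 T] by metis
  define a where "a t = deriv f (u0 t)" for t
  have conta: "continuous_on {0..T} a"
    unfolding a_def
  proof (rule continuous_on_compose2[OF _ trajectory_continuous[OF u0]])
    show "continuous_on \<D> (deriv f)"
      using f by (intro holomorphic_on_imp_continuous_on holomorphic_deriv) auto
  qed (use u0 in \<open>auto simp: is_trajectory_def\<close>)
  define A where "A t = integral {0..t} a" for t
  have A: "(A has_vector_derivative a t) (at t within {0..T})" if "t \<in> {0..T}" for t
    unfolding A_def by (rule integral_has_vector_derivative[OF conta that])
  then have contA: "continuous_on {0..T} A"
    using has_vector_derivative_continuous continuous_on_eq_continuous_within by blast
  have "\<exists>s\<in>{0..T}. \<forall>t\<in>{0..T}. cmod (exp (A t)) \<le> cmod (exp (A s))"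
    using T by (intro continuous_attains_sup continuous_intros contA) auto
  then obtain X where X: "\<And>t. t \<in> {0..T} \<Longrightarrow> cmod (exp (A t)) \<le> X" and "X \<ge> 0" using norm_ge_zero by metis
  have A0: "A 0 = 0" by (simp add: A_def)
  define B where "B = M * E\<^sup>2 * X * T"
  have B: "B \<ge> 0" using M \<open>X \<ge> 0\<close> T by (simp add: B_def)
  have main: "cmod ((u z T - u0 T) * exp (A T) - (z - z0)) \<le> B * (cmod (z - z0))\<^sup>2"
    if z: "z \<in> \<D>" "cmod (z - z0) < \<delta>" for z
  proof -
    have uz: "is_trajectory f z (u z)" using traj z by blast
    define W where "W t = (u z t - u0 t) * exp (A t)" for t
    define W' where "W' t = (- (f (u z t) - f (u0 t) - a t * (u z t - u0 t))) * exp (A t)" for t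
    have W: "(W has_vector_derivative W' t) (at t within {0..T})" if t: "t \<in> {0..T}" for t
    proof -
      have "(u z has_vector_derivative - f (u z t)) (at t within {0..T})"
        "(u0 has_vector_derivative - f (u0 t)) (at t within {0..T})"
        using uz u0 t unfolding is_trajectory_def by (auto intro: has_vector_derivative_within_subset)
      moreover have "((\<lambda>t. exp (A t)) has_vector_derivative a t * exp (A t)) (at t within {0..T})"
        using field_vector_diff_chain_within[OF A[OF t], of exp "exp (A t)"]
        by (simp add: o_def has_field_derivative_at_within)
      ultimately have "(W has_vector_derivative
          ((u z t - u0 t) * (a t * exp (A t)) + (- f (u z t) - - f (u0 t)) * exp (A t))) (at t within {0..T})"
        unfolding W_def by (intro has_vector_derivative_mult has_vector_derivative_diff)
      then show ?thesis by (simp add: W'_def algebra_simps)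
    qed
    have "cmod (W T - W 0) \<le> (M * E\<^sup>2 * (cmod (z - z0))\<^sup>2 * X) * norm (T - 0)"
    proof (rule differentiable_bound[of "{0..T}"])
      fix t assume t: "t \<in> {0..T}"
      show "(W has_derivative (\<lambda>h. h *\<^sub>R W' t)) (at t within {0..T})"
        using W[OF t] by (simp add: has_vector_derivative_def)
      have c: "cmod (u z t - u0 t) \<le> E * cmod (z - z0)"
        "cmod (f (u z t) - f (u0 t) - a t * (u z t - u0 t)) \<le> M * (cmod (u z t - u0 t))\<^sup>2"
        using close[OF uz z(2), of t] t by (auto simp: a_def)
      have "cmod (f (u z t) - f (u0 t) - a t * (u z t - u0 t)) \<le> M * (E * cmod (z - z0))\<^sup>2"
        using c(2) by (rule order_trans) (intro mult_left_mono power_mono c(1) M norm_ge_zero)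
      then have "cmod (W' t) \<le> M * (E * cmod (z - z0))\<^sup>2 * X"
        unfolding W'_def norm_mult norm_minus_cancel using X[OF t] M by (intro mult_mono) auto
      then show "onorm (\<lambda>h. h *\<^sub>R W' t) \<le> M * E\<^sup>2 * (cmod (z - z0))\<^sup>2 * X"
        by (simp add: onorm_scaleR_left onorm_id power_mult_distrib mult.assoc)
    qed (use T in auto)
    moreover have "W 0 = z - z0" using uz u0 by (simp add: W_def A0 is_trajectory_def)
    ultimately have "cmod (W T - (z - z0)) \<le> B * (cmod (z - z0))\<^sup>2"
      using T by (simp add: B_def mult_ac)
    then show ?thesis by (simp only: W_def)
  qed
  have "((\<lambda>z. (u z T - u0 T) / (z - z0) - exp (- A T)) \<longlongrightarrow> 0) (at z0)"
  proof (rule Lim_null_comparison)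
    show "((\<lambda>z. B * cmod (z - z0) * cmod (exp (- A T))) \<longlongrightarrow> 0) (at z0)"
      by (rule tendsto_eq_intros refl | simp)+
    obtain d where d: "d > 0" "ball z0 d \<subseteq> \<D>" using openE[OF open_ball z0] by blast
    have "\<forall>\<^sub>F z in at z0. z \<in> ball z0 (min d \<delta>) \<and> z \<noteq> z0"
      using d \<delta> eventually_at_ball'[of "min d \<delta>" z0 UNIV] by (auto elim!: eventually_mono)
    then show "\<forall>\<^sub>F z in at z0. norm ((u z T - u0 T) / (z - z0) - exp (- A T)) \<le> B * cmod (z - z0) * cmod (exp (- A T))"
    proof (rule eventually_mono)
      fix z assume z: "z \<in> ball z0 (min d \<delta>) \<and> z \<noteq> z0"
      then have "z \<in> \<D>" "cmod (z - z0) < \<delta>" using d(2) by (auto simp: dist_norm norm_minus_commute)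
      note m = main[OF this]
      have "(u z T - u0 T) / (z - z0) - exp (- A T) = ((u z T - u0 T) * exp (A T) - (z - z0)) / (z - z0) * exp (- A T)"
        using z by (simp add: field_simps exp_minus)
      also have "cmod \<dots> \<le> (B * (cmod (z - z0))\<^sup>2) / cmod (z - z0) * cmod (exp (- A T))"
        unfolding norm_mult norm_divide by (intro mult_right_mono divide_right_mono m) auto
      also have "\<dots> = B * cmod (z - z0) * cmod (exp (- A T))" using z by (simp add: power2_eq_square)
      finally show "norm ((u z T - u0 T) / (z - z0) - exp (- A T)) \<le> B * cmod (z - z0) * cmod (exp (- A T))" .
    qed
  qed
  then have "((\<lambda>z. u z T) has_field_derivative exp (- A T)) (at z0)"
    unfolding has_field_derivative_iff u0_def by (simp add: LIM_zero_iff)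
  then show ?thesis by (auto simp: field_differentiable_def)
qed

text \<open>By the Schwarz lemma for the flow map the modulus of a trajectory never exceeds its initial
  value, whereas \<open>z \<bullet> f z < 0\<close> would make it increase at time zero.\<close>

lemma generator_inner_nonneg:
  assumes gen: "generator f" and f0: "f 0 = 0" and z: "z \<in> \<D>"
  shows "0 \<le> z \<bullet> f z"
proof -
  have f: "f holomorphic_on \<D>" and ex: "\<And>z. z \<in> \<D> \<Longrightarrow> \<exists>u. is_trajectory f z u"
    and uniq: "\<And>z u v t. z \<in> \<D> \<Longrightarrow> is_trajectory f z u \<Longrightarrow> is_trajectory f z v \<Longrightarrow> 0 \<le> t \<Longrightarrow> u t = v t"
    using gen unfolding generator_def by blast+
  define u where "u z = (SOME u. is_trajectory f z u)" for z
  have u: "is_trajectory f z (u z)" if "z \<in> \<D>" for z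
    unfolding u_def using ex[OF that] by (rule someI_ex)
  have "is_trajectory f 0 (\<lambda>_. 0)" by (simp add: is_trajectory_def f0)
  then have u0: "u 0 t = 0" if "0 \<le> t" for t
    using uniq[OF _ u, of 0 "\<lambda>_. 0" t] that by simp
  have contr: "cmod (u z t) \<le> cmod z" if t: "0 < t" for t
  proof -
    have "(\<lambda>z. u z t) holomorphic_on \<D>"
      using flow_map_differentiable[OF f u t]
      by (simp add: holomorphic_on_def field_differentiable_at_within)
    moreover have "\<And>z. cmod z < 1 \<Longrightarrow> cmod (u z t) < 1"
      using u t unfolding is_trajectory_def by simp
    ultimately show ?thesis using Schwarz_Lemma(1)[of "\<lambda>z. u z t" z] u0 t z by simp
  qed
  show ?thesis
  proof (rule ccontr)
    assume "\<not> 0 \<le> z \<bullet> f z"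
    have uz: "u z 0 = z" "(u z has_vector_derivative - f z) (at 0 within {0..})"
      using u[OF z] unfolding is_trajectory_def by (auto dest: spec[of _ 0])
    have "((\<lambda>t. u z t \<bullet> u z t) has_vector_derivative (u z 0 \<bullet> (- f z) + (- f z) \<bullet> u z 0)) (at 0 within {0..})"
      by (rule bounded_bilinear.has_vector_derivative[OF bounded_bilinear_inner uz(2) uz(2)])
    then have "((\<lambda>t. u z t \<bullet> u z t) has_real_derivative - 2 * (z \<bullet> f z)) (at 0 within {0..})"
      by (simp add: has_real_derivative_iff_has_vector_derivative uz(1) inner_commute)
    then obtain d where d: "d > 0" "\<And>h. h > 0 \<Longrightarrow> 0 + h \<in> {0..} \<Longrightarrow> h < d \<Longrightarrow> u z 0 \<bullet> u z 0 < u z (0 + h) \<bullet> u z (0 + h)"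
      using has_real_derivative_pos_inc_right[of "\<lambda>t. u z t \<bullet> u z t" "- 2 * (z \<bullet> f z)" 0 "{0..}"]
        \<open>\<not> 0 \<le> z \<bullet> f z\<close> by auto
    have "z \<bullet> z < u z (d / 2) \<bullet> u z (d / 2)" using d(2)[of "d/2"] d(1) uz(1) by simp
    moreover have "(cmod (u z (d / 2)))\<^sup>2 \<le> (cmod z)\<^sup>2" using contr[of "d/2"] d(1) by (intro power_mono) auto
    ultimately show False by (simp add: dot_square_norm)
  qed
qed

section \<open>Functions with positive real part and the inverse of z (1 + P z)\<close>

text \<open>Otherwise the open image of a nonconstant \<open>P\<close> would contain a point of the imaginary axis
  together with points to its left.\<close>

lemma Re_pos_of_nonneg:
  assumes P: "P holomorphic_on \<D>" and nonneg: "\<And>z. z \<in> \<D> \<Longrightarrow> 0 \<le> Re (P z)"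
    and pos: "0 < Re (P 0)" and a: "a \<in> \<D>"
  shows "0 < Re (P a)"
proof (cases "P constant_on \<D>")
  case True
  then have "P a = P 0" using a unfolding constant_on_def by force
  then show ?thesis using pos by simp
next
  case False
  have "open (P ` \<D>)"
    by (rule open_mapping_thm[OF P open_ball connected_ball open_ball order_refl False])
  then obtain e where e: "e > 0" "ball (P a) e \<subseteq> P ` \<D>"
    using openE[of "P ` \<D>" "P a"] a by blast
  have "P a - of_real (e / 2) \<in> ball (P a) e" using e(1) by (simp add: dist_norm)
  then have "P a - of_real (e / 2) \<in> P ` \<D>" using e(2) by (rule subsetD[rotated])
  then obtain b where b: "b \<in> \<D>" "P a - of_real (e / 2) = P b" by (rule imageE)
  have "Re (P a) - e / 2 = Re (P b)" using arg_cong[OF b(2), of Re] by simp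
  then show ?thesis using nonneg[OF b(1)] e(1) by simp
qed

lemma cmod_add_cnj_sq: "(cmod (u + cnj v))\<^sup>2 = (cmod (u - v))\<^sup>2 + 4 * Re u * Re v"
  unfolding cmod_power2 by (simp add: power2_eq_square algebra_simps)

text \<open>Schwarz lemma for \<open>(P z - P 0) / (P z + cnj (P 0))\<close>, the Cayley transform that carries
  the right half-plane to the disk and \<open>P 0\<close> to the origin.\<close>

lemma half_plane_schwarz:
  assumes P: "P holomorphic_on \<D>" and pos: "\<And>z. z \<in> \<D> \<Longrightarrow> 0 < Re (P z)"
  shows "\<And>z. z \<in> \<D> \<Longrightarrow> cmod (P z - P 0) \<le> cmod z * cmod (P z + cnj (P 0))"
    and "cmod (deriv P 0) \<le> 2 * Re (P 0)"
proof -
  define \<omega> where "\<omega> z = (P z - P 0) / (P z + cnj (P 0))" for z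
  have P0: "0 < Re (P 0)" using pos[of 0] by simp
  have nz: "P z + cnj (P 0) \<noteq> 0" if "z \<in> \<D>" for z
  proof
    assume "P z + cnj (P 0) = 0"
    then have "Re (P z) + Re (P 0) = 0" by (metis cnj.simps(1) plus_complex.sel(1) zero_complex.sel(1))
    then show False using pos[OF that] P0 by simp
  qed
  have hol: "\<omega> holomorphic_on \<D>" unfolding \<omega>_def
    using nz by (intro holomorphic_intros P) auto
  have \<omega>0: "\<omega> 0 = 0" by (simp add: \<omega>_def)
  have lt: "cmod (\<omega> z) < 1" if "cmod z < 1" for z
  proof -
    have z: "z \<in> \<D>" using that by simp
    have "(cmod (P z - P 0))\<^sup>2 < (cmod (P z + cnj (P 0)))\<^sup>2"
      using pos[OF z] P0 by (simp add: cmod_add_cnj_sq)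
    then have "cmod (P z - P 0) < cmod (P z + cnj (P 0))" by (rule power2_less_imp_less) simp
    then show ?thesis using nz[OF z] by (simp add: \<omega>_def norm_divide)
  qed
  show "cmod (P z - P 0) \<le> cmod z * cmod (P z + cnj (P 0))" if z: "z \<in> \<D>" for z
  proof -
    have "cmod (\<omega> z) \<le> cmod z" using Schwarz_Lemma(1)[OF hol \<omega>0 lt] z by simp
    then show ?thesis using nz[OF z] by (simp add: \<omega>_def norm_divide field_simps)
  qed
  have "(P has_field_derivative deriv P 0) (at 0)"
    by (rule holomorphic_derivI[OF P]) auto
  then have "(\<omega> has_field_derivative
     ((deriv P 0 - 0) * (P 0 + cnj (P 0)) - (P 0 - P 0) * (deriv P 0 + 0)) / ((P 0 + cnj (P 0)) * (P 0 + cnj (P 0)))) (at 0)"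
    unfolding \<omega>_def using nz[of 0] by (intro DERIV_divide DERIV_diff DERIV_add DERIV_const) auto
  then have "deriv \<omega> 0 = deriv P 0 / (P 0 + cnj (P 0))"
    using nz[of 0] by (simp add: DERIV_imp_deriv)
  moreover have "P 0 + cnj (P 0) = of_real (2 * Re (P 0))" by (simp add: complex_add_cnj)
  moreover have "cmod (deriv \<omega> 0) \<le> 1" using Schwarz_Lemma(2)[OF hol \<omega>0 lt, of 0] by simp
  ultimately have "cmod (deriv P 0 / of_real (2 * Re (P 0))) \<le> 1" by simp
  then show "cmod (deriv P 0) \<le> 2 * Re (P 0)"
    unfolding norm_divide norm_of_real using P0 by (simp add: divide_le_eq)
qed

lemma half_plane_distance_bound:
  assumes P: "P holomorphic_on \<D>" and pos: "\<And>z. z \<in> \<D> \<Longrightarrow> 0 < Re (P z)" and z: "z \<in> \<D>"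
  shows "(1 - cmod z) * cmod (P z - P 0) \<le> 2 * Re (P 0) * cmod z"
proof -
  have P0: "0 < Re (P 0)" using pos[of 0] by simp
  have "P z + cnj (P 0) = (P z - P 0) + (P 0 + cnj (P 0))" by simp
  also have "P 0 + cnj (P 0) = of_real (2 * Re (P 0))" by (simp add: complex_add_cnj)
  finally have "cmod (P z + cnj (P 0)) \<le> cmod (P z - P 0) + 2 * Re (P 0)"
    using norm_triangle_ineq[of "P z - P 0" "of_real (2 * Re (P 0))"] P0 by (simp only: norm_of_real)
  then have "cmod z * cmod (P z + cnj (P 0)) \<le> cmod z * (cmod (P z - P 0) + 2 * Re (P 0))"
    by (intro mult_left_mono) auto
  then show ?thesis using half_plane_schwarz(1)[OF P pos z] by (simp add: algebra_simps)
qed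

text \<open>The lower Harnack inequality. With \<open>s = Re (P z)\<close>, \<open>x = Re (P 0)\<close> and \<open>t = |z|\<close>, the
  Schwarz estimate squared reads \<open>(1 - t\<^sup>2) |P z + cnj (P 0)|\<^sup>2 \<le> 4 s x\<close>; dropping imaginary parts
  leaves \<open>(x - s)\<^sup>2 \<le> t\<^sup>2 (s + x)\<^sup>2\<close>.\<close>

lemma half_plane_Re_lower_bound:
  assumes P: "P holomorphic_on \<D>" and pos: "\<And>z. z \<in> \<D> \<Longrightarrow> 0 < Re (P z)" and z: "z \<in> \<D>"
  shows "Re (P 0) * (1 - cmod z) \<le> Re (P z) * (1 + cmod z)"
proof -
  let ?s = "Re (P z)" and ?x = "Re (P 0)" and ?t = "cmod z"
  have t: "0 \<le> ?t" "?t < 1" using z by auto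
  have P0: "0 < ?x" using pos[of 0] by simp
  have "(cmod (P z - P 0))\<^sup>2 \<le> (?t * cmod (P z + cnj (P 0)))\<^sup>2"
    by (rule power_mono[OF half_plane_schwarz(1)[OF P pos z]]) auto
  then have "(1 - ?t\<^sup>2) * (cmod (P z + cnj (P 0)))\<^sup>2 \<le> 4 * ?s * ?x"
    by (simp add: power_mult_distrib cmod_add_cnj_sq algebra_simps)
  moreover have "(1 - ?t\<^sup>2) * (?s + ?x)\<^sup>2 \<le> (1 - ?t\<^sup>2) * (cmod (P z + cnj (P 0)))\<^sup>2"
    using power_le_one[OF t(1) less_imp_le[OF t(2)], of 2]
    by (intro mult_left_mono) (simp_all add: cmod_power2[of "P z + cnj (P 0)"])
  ultimately have "(?x - ?s)\<^sup>2 \<le> (?t * (?s + ?x))\<^sup>2"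
    by (simp add: power2_eq_square algebra_simps)
  then have "?x - ?s \<le> ?t * (?s + ?x)"
    by (rule power2_le_imp_le) (use t P0 pos[OF z] in auto)
  then show ?thesis by (simp add: algebra_simps)
qed

text \<open>The derivative estimate at the origin, transported to \<open>a\<close> by a disk automorphism whose
  derivative at the origin is \<open>1 - |a|\<^sup>2\<close>.\<close>

lemma half_plane_schwarz_pick:
  assumes P: "P holomorphic_on \<D>" and pos: "\<And>z. z \<in> \<D> \<Longrightarrow> 0 < Re (P z)" and a: "a \<in> \<D>"
  shows "(1 - (cmod a)\<^sup>2) * cmod (deriv P a) \<le> 2 * Re (P a)"
proof -
  let ?\<phi> = "Moebius_function 0 (- a)"
  have a1: "cmod (- a) < 1" using a by simp
  have \<phi>: "?\<phi> holomorphic_on \<D>" "?\<phi> ` \<D> \<subseteq> \<D>"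
    using Moebius_function_holomorphic[OF a1] Moebius_function_norm_lt_1[OF a1] by auto
  have \<phi>0: "?\<phi> 0 = a" by (simp add: Moebius_function_simple)
  have hol: "(P \<circ> ?\<phi>) holomorphic_on \<D>"
    by (rule holomorphic_on_compose_gen[OF \<phi>(1) P \<phi>(2)])
  have "((\<lambda>z. (z - - a) / (1 - cnj (- a) * z)) has_field_derivative
      ((1 - 0) * (1 - cnj (- a) * 0) - (0 - - a) * (0 - cnj (- a))) / ((1 - cnj (- a) * 0) * (1 - cnj (- a) * 0))) (at 0)"
    by (intro DERIV_divide DERIV_diff DERIV_const DERIV_ident DERIV_cmult_Id) auto
  then have "(?\<phi> has_field_derivative 1 - a * cnj a) (at 0)"
    by (simp add: Moebius_function_simple[abs_def])
  then have d\<phi>: "(?\<phi> has_field_derivative of_real (1 - (cmod a)\<^sup>2)) (at 0)"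
    by (simp only: of_real_diff of_real_1 complex_norm_square)
  have "(P has_field_derivative deriv P a) (at (?\<phi> 0))"
    unfolding \<phi>0 by (rule holomorphic_derivI[OF P open_ball a])
  then have "((P \<circ> ?\<phi>) has_field_derivative deriv P a * of_real (1 - (cmod a)\<^sup>2)) (at 0)"
    by (rule DERIV_chain[OF _ d\<phi>])
  then have "deriv (P \<circ> ?\<phi>) 0 = deriv P a * of_real (1 - (cmod a)\<^sup>2)" by (rule DERIV_imp_deriv)
  moreover have "cmod (deriv (P \<circ> ?\<phi>) 0) \<le> 2 * Re ((P \<circ> ?\<phi>) 0)"
    using hol by (rule half_plane_schwarz(2)) (use \<phi>(2) in \<open>auto intro!: pos simp: image_subset_iff\<close>)
  moreover have "cmod (of_real (1 - (cmod a)\<^sup>2)) = 1 - (cmod a)\<^sup>2"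
    using a by (subst norm_of_real) (simp add: power_le_one abs_square_le_1)
  ultimately show ?thesis by (simp add: \<phi>0 norm_mult mult.commute del: of_real_diff)
qed

text \<open>The left-hand side is \<open>F'(z) - F'(0)\<close> for \<open>F(z) = z (1 + P z)\<close>. The bound is attained by the
  half-plane map \<open>P z = x (1 + z) / (1 - z)\<close> at positive \<open>z\<close>.\<close>

lemma half_plane_derivative_bound:
  assumes P: "P holomorphic_on \<D>" and pos: "\<And>z. z \<in> \<D> \<Longrightarrow> 0 < Re (P z)" and z: "z \<in> \<D>"
  shows "cmod (P z - P 0 + z * deriv P z) \<le> 2 * Re (P 0) * (1 / (1 - cmod z)\<^sup>2 - 1)"
proof -
  let ?t = "cmod z" and ?x = "Re (P 0)"
  have t: "0 \<le> ?t" "?t < 1" using z by auto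
  have P0: "0 < ?x" using pos[of 0] by simp
  have d: "cmod (P z - P 0) \<le> 2 * ?x * ?t / (1 - ?t)"
    using half_plane_distance_bound[OF P pos z] t by (simp add: field_simps)
  have "Re (P z) \<le> ?x + cmod (P z - P 0)" using complex_Re_le_cmod[of "P z - P 0"] by simp
  also have "\<dots> \<le> ?x + 2 * ?x * ?t / (1 - ?t)" using d by simp
  also have "\<dots> = ?x * (1 + ?t) / (1 - ?t)" using t by (simp add: field_simps)
  finally have "(1 - ?t\<^sup>2) * cmod (deriv P z) \<le> 2 * (?x * (1 + ?t) / (1 - ?t))"
    using half_plane_schwarz_pick[OF P pos z] by linarith
  moreover have "1 - ?t\<^sup>2 = (1 - ?t) * (1 + ?t)" by (simp add: power2_eq_square algebra_simps)
  ultimately have "(1 + ?t) * ((1 - ?t) * cmod (deriv P z)) \<le> (1 + ?t) * (2 * ?x / (1 - ?t))"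
    by (simp add: mult_ac)
  then have "(1 - ?t) * cmod (deriv P z) \<le> 2 * ?x / (1 - ?t)"
    by (rule mult_left_le_imp_le) (use t in linarith)
  then have d': "cmod (deriv P z) \<le> 2 * ?x / (1 - ?t)\<^sup>2"
    using t by (simp add: pos_le_divide_eq power2_eq_square mult_ac)
  have "cmod (P z - P 0 + z * deriv P z) \<le> cmod (P z - P 0) + ?t * cmod (deriv P z)"
    using norm_triangle_ineq[of "P z - P 0" "z * deriv P z"] by (simp add: norm_mult)
  also have "\<dots> \<le> 2 * ?x * ?t / (1 - ?t) + ?t * (2 * ?x / (1 - ?t)\<^sup>2)"
    using d d' t by (intro add_mono mult_left_mono) auto
  also have "\<dots> = 2 * ?x * (1 / (1 - ?t)\<^sup>2 - 1)"
  proof -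
    have eq: "2 * ?x * (1 - s) / s + (1 - s) * (2 * ?x / s\<^sup>2) = 2 * ?x * (1 / s\<^sup>2 - 1)" if "0 < s" for s
      using that by (simp add: field_simps power2_eq_square)
    show ?thesis using eq[of "1 - ?t"] t(2) by simp
  qed
  finally show ?thesis .
qed

text \<open>A solution is a fixed point of \<open>w / (1 + P z)\<close>, which maps the closed disk of radius \<open>|w|\<close>
  into itself because \<open>|1 + P z| \<ge> 1\<close>.\<close>

lemma equation_solvable:
  assumes P: "P holomorphic_on \<D>" and pos: "\<And>z. z \<in> \<D> \<Longrightarrow> 0 < Re (P z)" and w: "w \<in> \<D>"
  shows "\<exists>z\<in>\<D>. z * (1 + P z) = w"
proof (cases "w = 0")
  case True then show ?thesis by (intro bexI[of _ 0]) auto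
next
  case False
  have sub: "cball 0 (cmod w) \<subseteq> \<D>" using w by auto
  have ge1: "1 \<le> cmod (1 + P z)" if "z \<in> \<D>" for z
    using pos[OF that] complex_Re_le_cmod[of "1 + P z"] by simp
  then have nz: "1 + P z \<noteq> 0" if "z \<in> \<D>" for z using that by fastforce
  obtain z where z: "z \<in> cball 0 (cmod w)" "w / (1 + P z) = z"
  proof (rule brouwer_ball[of "cmod w" 0 "\<lambda>z. w / (1 + P z)"])
    have "continuous_on \<D> P" using P by (rule holomorphic_on_imp_continuous_on)
    then show "continuous_on (cball 0 (cmod w)) (\<lambda>z. w / (1 + P z))"
      using nz sub by (intro continuous_intros) (auto intro: continuous_on_subset)
    have "cmod w / cmod (1 + P z) \<le> cmod w" if "z \<in> \<D>" for z
      using ge1[OF that] False by (simp add: divide_le_eq mult_left_le)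
    then show "(\<lambda>z. w / (1 + P z)) \<in> cball 0 (cmod w) \<rightarrow> cball 0 (cmod w)"
      using sub by (auto simp: norm_divide)
  qed (use False in auto)
  then have "z \<in> \<D>" using sub by blast
  then show ?thesis using z nz[of z] by (intro bexI[of _ z]) (auto simp: field_simps)
qed

text \<open>By Harnack, \<open>|z (1 + P z)|\<close> is at least \<open>t (1 + x (1 - t) / (1 + t))\<close> with \<open>t = |z|\<close>, and
  this reaches the value one exactly at \<open>t = 1/(x - 1)\<close> and at \<open>t = 1\<close>.\<close>

lemma solution_small:
  assumes P: "P holomorphic_on \<D>" and pos: "\<And>z. z \<in> \<D> \<Longrightarrow> 0 < Re (P z)" and x: "1 < Re (P 0)"
    and z: "z \<in> \<D>" and w: "cmod (z * (1 + P z)) < 1"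
  shows "cmod z < 1 / (Re (P 0) - 1)"
proof -
  let ?t = "cmod z" and ?x = "Re (P 0)"
  have t: "0 \<le> ?t" "?t < 1" using z by auto
  have "(1 + ?t) + ?x * (1 - ?t) \<le> (1 + Re (P z)) * (1 + ?t)"
    using half_plane_Re_lower_bound[OF P pos z] by (simp add: algebra_simps)
  also have "\<dots> \<le> cmod (1 + P z) * (1 + ?t)"
    using complex_Re_le_cmod[of "1 + P z"] t by (intro mult_right_mono) auto
  finally have "?t * ((1 + ?t) + ?x * (1 - ?t)) \<le> ?t * (cmod (1 + P z) * (1 + ?t))"
    using t by (intro mult_left_mono) auto
  also have "\<dots> = cmod (z * (1 + P z)) * (1 + ?t)" by (simp add: norm_mult)
  also have "\<dots> < 1 * (1 + ?t)" using w t(1) by (intro mult_strict_right_mono add_pos_nonneg) simp_all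
  finally have "0 < (1 - ?t) * (1 - (?x - 1) * ?t)" by (simp add: algebra_simps power2_eq_square)
  then have "0 < 1 - (?x - 1) * ?t" using t by (simp add: zero_less_mult_iff)
  then show ?thesis using x by (simp add: field_simps)
qed

text \<open>For given \<open>u\<close>, the points \<open>z\<close> with \<open>|u - z| \<le> k |z|\<close> form a disk with centre
  \<open>u / (1 - k\<^sup>2)\<close>. Passing to this centre keeps the ratio of radius to modulus of the centre equal to
  \<open>k\<close>; with centre \<open>u\<close> it would deteriorate to \<open>k / (1 - k)\<close>.\<close>

lemma apollonius:
  fixes z u :: complex
  assumes k: "k < 1" "0 \<le> k" and le: "cmod (u - z) \<le> k * cmod z"
  shows "cmod (z - u / of_real (1 - k\<^sup>2)) \<le> k / (1 - k\<^sup>2) * cmod u"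
proof -
  have K: "0 < 1 - k\<^sup>2" using k by (simp add: power_less_one_iff abs_square_less_1)
  have "(cmod (u - z))\<^sup>2 \<le> k\<^sup>2 * (cmod z)\<^sup>2"
    using power_mono[OF le, of 2] by (simp add: power_mult_distrib)
  then have "(1 - k\<^sup>2) * (cmod (u - z))\<^sup>2 \<le> (1 - k\<^sup>2) * (k\<^sup>2 * (cmod z)\<^sup>2)"
    using K by (intro mult_left_mono) auto
  then have "(cmod (of_real (1 - k\<^sup>2) * z - u))\<^sup>2 \<le> (k * cmod u)\<^sup>2"
    unfolding power_mult_distrib cmod_power2 by (simp add: power2_eq_square algebra_simps)
  then have "cmod (of_real (1 - k\<^sup>2) * z - u) \<le> k * cmod u"
    by (rule power2_le_imp_le) (use k in auto)
  then have "cmod (of_real (1 - k\<^sup>2) * z - u) / (1 - k\<^sup>2) \<le> k * cmod u / (1 - k\<^sup>2)"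
    using K by (intro divide_right_mono) auto
  moreover have "cmod (of_real (1 - k\<^sup>2) * z - u) / (1 - k\<^sup>2) = cmod ((of_real (1 - k\<^sup>2) * z - u) / of_real (1 - k\<^sup>2))"
    using K by (simp only: norm_divide norm_of_real abs_of_pos)
  moreover have "(of_real (1 - k\<^sup>2) * z - u) / of_real (1 - k\<^sup>2) = z - u / of_real (1 - k\<^sup>2)"
    using K by (subst diff_divide_distrib) (simp del: of_real_diff)
  ultimately show ?thesis by simp
qed

text \<open>All solutions of \<open>F z = w\<close> lie in the disk of radius \<open>1/(x - 1)\<close>, on which
  \<open>1 - |z| \<ge> (x - 2)/(x - 1)\<close>. There the derivative bound becomes the left-hand side of the hypothesis on
  \<open>k\<close>, and \<open>|1 + P 0| \<ge> 1 + x\<close>, so \<open>F\<close> deviates from the linear map \<open>(1 + P 0) z\<close> by a Lipschitz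
  map with constant \<open>k |1 + P 0|\<close>. This makes \<open>F\<close> injective, and the Apollonius estimate turns it into a
  statement on increments of the inverse.\<close>

lemma inverse_close_to_linear:
  assumes P: "P holomorphic_on \<D>" and pos: "\<And>z. z \<in> \<D> \<Longrightarrow> 0 < Re (P z)"
    and x: "x = Re (P 0)" "2 < x"
    and k: "k < 1" "2 * x * (2 * x - 3) / (x - 2)\<^sup>2 \<le> k * (1 + x)"
  defines "F \<equiv> \<lambda>z. z * (1 + P z)"
  shows "inj_on F (ball 0 (1 / (x - 1)))"
    and "\<And>G. (\<And>w. w \<in> \<D> \<Longrightarrow> G w \<in> \<D> \<and> F (G w) = w) \<Longrightarrow> G holomorphic_on \<D> \<and>
      (\<exists>c. c \<noteq> 0 \<and> (k * cmod c)-lipschitz_on \<D> (\<lambda>w. G w - c * w))"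
proof -
  define C where "C = 1 + P 0"
  define S where "S = ball (0::complex) (1 / (x - 1))"
  have C: "1 + x \<le> cmod C" using complex_Re_le_cmod[of C] by (simp add: C_def x)
  have k0: "0 \<le> k"
  proof -
    have "0 \<le> 2 * x * (2 * x - 3) / (x - 2)\<^sup>2" using x by auto
    then have "0 \<le> k * (1 + x)" using k(2) by linarith
    then show ?thesis using x(2) by (simp add: zero_le_mult_iff)
  qed
  have "1 / (x - 1) < 1" using x(2) by simp
  then have sub: "S \<subseteq> \<D>" unfolding S_def by (intro subset_ball less_imp_le)
  have close: "cmod (F a - F b - C * (a - b)) \<le> k * cmod C * cmod (a - b)" if ab: "a \<in> S" "b \<in> S" for a b
  proof -
    have "cmod ((F a - C * a) - (F b - C * b)) \<le> k * cmod C * cmod (a - b)"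
    proof (rule field_differentiable_bound[of S])
      show "convex S" by (simp add: S_def)
      fix z assume z: "z \<in> S"
      then have zD: "z \<in> \<D>" using sub by blast
      have "(P has_field_derivative deriv P z) (at z within S)"
        by (rule holomorphic_derivI[OF P open_ball zD])
      then have "((\<lambda>z. z * (1 + P z) - C * z) has_field_derivative
          (1 * (1 + P z) + (0 + deriv P z) * z - C)) (at z within S)"
        by (intro DERIV_diff DERIV_mult DERIV_add DERIV_const DERIV_ident DERIV_cmult_Id)
      then show "((\<lambda>z. F z - C * z) has_field_derivative (P z - P 0 + z * deriv P z)) (at z within S)"
        by (simp add: F_def C_def algebra_simps)
      have t: "cmod z \<le> 1 / (x - 1)" using z by (simp add: S_def)
      have "(x - 2) / (x - 1) = 1 - 1 / (x - 1)" using x(2) by (simp add: field_simps)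
      then have le: "(x - 2) / (x - 1) \<le> 1 - cmod z" using t by simp
      have p: "0 < (x - 2) / (x - 1)" using x(2) by simp
      have "1 / (1 - cmod z)\<^sup>2 \<le> 1 / ((x - 2) / (x - 1))\<^sup>2"
        using p by (intro divide_left_mono power_mono le mult_pos_pos zero_less_power) (use le in auto)
      then have "2 * x * (1 / (1 - cmod z)\<^sup>2 - 1) \<le> 2 * x * (1 / ((x - 2) / (x - 1))\<^sup>2 - 1)"
        using x(2) by (intro mult_left_mono) auto
      also have "1 / ((x - 2) / (x - 1))\<^sup>2 - 1 = ((x - 1)\<^sup>2 - (x - 2)\<^sup>2) / (x - 2)\<^sup>2"
        using x(2) by (simp add: power_divide divide_simps)
      also have "(x - 1)\<^sup>2 - (x - 2)\<^sup>2 = 2 * x - 3" by (simp add: power2_eq_square algebra_simps)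
      also have "2 * x * ((2 * x - 3) / (x - 2)\<^sup>2) \<le> k * (1 + x)" using k(2) by simp
      also have "\<dots> \<le> k * cmod C" using C k0 by (intro mult_left_mono)
      finally show "cmod (P z - P 0 + z * deriv P z) \<le> k * cmod C"
        using half_plane_derivative_bound[OF P pos zD] x(1) by simp
    qed (use ab in auto)
    moreover have "(F a - C * a) - (F b - C * b) = F a - F b - C * (a - b)" by (simp add: algebra_simps)
    ultimately show ?thesis by simp
  qed
  have C0: "0 < cmod C" using C x(2) by linarith
  show inj: "inj_on F (ball 0 (1 / (x - 1)))"
  proof (rule inj_onI)
    fix a b assume ab: "a \<in> ball 0 (1 / (x - 1))" "b \<in> ball 0 (1 / (x - 1))" "F a = F b"
    have "cmod C * cmod (a - b) \<le> k * (cmod C * cmod (a - b))"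
      using close[of a b] ab by (simp add: S_def norm_mult)
    then have "(1 - k) * (cmod C * cmod (a - b)) \<le> 0" by (simp add: algebra_simps)
    then have "cmod C * cmod (a - b) \<le> 0" using k(1) by (simp add: mult_le_0_iff)
    then have "cmod (a - b) \<le> 0" using C0 by (simp add: mult_le_0_iff)
    then show "a = b" by simp
  qed
  fix G assume G: "\<And>w. w \<in> \<D> \<Longrightarrow> G w \<in> \<D> \<and> F (G w) = w"
  have GS: "G w \<in> S" if w: "w \<in> \<D>" for w
  proof -
    have "cmod (G w * (1 + P (G w))) < 1" using G[OF w] w by (simp add: F_def)
    then have "cmod (G w) < 1 / (Re (P 0) - 1)" by (intro solution_small[OF P pos]) (use x G[OF w] in auto)
    then show ?thesis by (simp add: S_def x)
  qed
  have FS: "F holomorphic_on S" unfolding F_def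
    by (intro holomorphic_intros holomorphic_on_subset[OF P sub])
  obtain g where g: "g holomorphic_on F ` S" "\<And>z. z \<in> S \<Longrightarrow> g (F z) = z"
    using holomorphic_has_inverse[OF FS _ inj[folded S_def]] S_def open_ball by metis
  have "\<D> \<subseteq> F ` S" using G GS by (metis imageI subsetI)
  then have "g holomorphic_on \<D>" using g(1) by (rule holomorphic_on_subset[rotated])
  moreover have "g w = G w" if "w \<in> \<D>" for w
    using g(2)[OF GS[OF that]] G[OF that] by simp
  ultimately have holG: "G holomorphic_on \<D>" by (rule holomorphic_transform)
  have K: "0 < 1 - k\<^sup>2" using k(1) k0 by (simp add: power_less_one_iff abs_square_less_1)
  define c where "c = 1 / (C * of_real (1 - k\<^sup>2))"
  have Cn: "C \<noteq> 0" using C0 by auto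
  have cn: "cmod c = 1 / (cmod C * (1 - k\<^sup>2))"
    unfolding c_def norm_divide norm_mult norm_of_real using K by simp
  have "(k * cmod c)-lipschitz_on \<D> (\<lambda>w. G w - c * w)"
  proof (rule lipschitz_onI)
    show "0 \<le> k * cmod c" using k0 by simp
    fix a b assume a: "a \<in> \<D>" and b: "b \<in> \<D>"
    have "cmod (a - b - C * (G a - G b)) \<le> k * cmod C * cmod (G a - G b)"
      using close[OF GS[OF a] GS[OF b]] G a b by simp
    moreover have "a - b - C * (G a - G b) = C * ((a - b) / C - (G a - G b))"
      using Cn by (simp add: field_simps)
    ultimately have "cmod C * cmod ((a - b) / C - (G a - G b)) \<le> cmod C * (k * cmod (G a - G b))"
      by (simp add: norm_mult mult_ac)
    then have "cmod ((a - b) / C - (G a - G b)) \<le> k * cmod (G a - G b)"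
      by (rule mult_left_le_imp_le[OF _ C0])
    then have "cmod ((G a - G b) - (a - b) / C / of_real (1 - k\<^sup>2)) \<le> k / (1 - k\<^sup>2) * cmod ((a - b) / C)"
      by (rule apollonius[OF k(1) k0])
    moreover have "(G a - G b) - (a - b) / C / of_real (1 - k\<^sup>2) = (G a - c * a) - (G b - c * b)"
      by (simp add: c_def diff_divide_distrib algebra_simps del: of_real_diff)
    moreover have "k / (1 - k\<^sup>2) * cmod ((a - b) / C) = k * cmod c * cmod (a - b)"
      by (simp add: cn norm_divide)
    ultimately show "dist (G a - c * a) (G b - c * b) \<le> k * cmod c * dist a b"
      by (simp only: dist_norm)
  qed
  moreover have "c \<noteq> 0" using cn C0 K by auto
  ultimately show "G holomorphic_on \<D> \<and> (\<exists>c. c \<noteq> 0 \<and> (k * cmod c)-lipschitz_on \<D> (\<lambda>w. G w - c * w))"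
    using holG by blast
qed

section \<open>Extension by reflection\<close>

definition disk_reflection :: "complex \<Rightarrow> complex" where
  "disk_reflection w = (if cmod w \<le> 1 then w else 1 / cnj w)"

lemma disk_reflection_in_cball: "disk_reflection w \<in> cball 0 1"
  by (auto simp: disk_reflection_def norm_divide divide_le_eq)

text \<open>After squaring and division by \<open>1 - 1/\<beta>\<close> with \<open>\<beta> = |b|\<^sup>2\<close>, the claim is
  \<open>2 (a \<bullet> b) \<le> \<beta> + 1\<close>, which follows from \<open>a \<bullet> b \<le> |b|\<close> and \<open>2 |b| \<le> |b|\<^sup>2 + 1\<close>.\<close>

lemma reflected_point_closer:
  assumes a: "cmod a \<le> 1" and b: "1 < cmod b"
  shows "cmod (a - 1 / cnj b) \<le> cmod (a - b)"
proof -
  define \<beta> where "\<beta> = (cmod b)\<^sup>2"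
  have \<beta>: "1 < \<beta>" using b by (simp add: \<beta>_def one_less_power)
  have bb: "b \<bullet> b = \<beta>" by (simp add: \<beta>_def dot_square_norm)
  have eq: "1 / cnj b = (1 / \<beta>) *\<^sub>R b"
    using \<beta> complex_norm_square[of b] b
    by (simp add: \<beta>_def scaleR_conv_of_real divide_simps)
  have "a \<bullet> b \<le> cmod a * cmod b" by (rule norm_cauchy_schwarz)
  also have "\<dots> \<le> 1 * cmod b" using a by (intro mult_right_mono) auto
  finally have "a \<bullet> b \<le> cmod b" by simp
  moreover have "0 \<le> (cmod b - 1)\<^sup>2" by simp
  ultimately have "2 * (a \<bullet> b) \<le> \<beta> + 1" by (simp add: \<beta>_def power2_diff)
  then have "(1 - 1 / \<beta>) * (2 * (a \<bullet> b)) \<le> (1 - 1 / \<beta>) * (\<beta> + 1)"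
    using \<beta> by (intro mult_left_mono) auto
  moreover have "(1 - 1 / \<beta>) * (\<beta> + 1) = \<beta> - 1 / \<beta>" using \<beta> by (simp add: field_simps)
  ultimately have "1 / \<beta> - 2 * (a \<bullet> b) / \<beta> \<le> \<beta> - 2 * (a \<bullet> b)"
    by (simp add: left_diff_distrib)
  moreover have "(cmod (a - 1 / cnj b))\<^sup>2 = a \<bullet> a - 2 * (a \<bullet> b) / \<beta> + 1 / \<beta>"
    unfolding eq dot_square_norm[symmetric] using \<beta>
    by (simp add: inner_diff inner_commute bb)
  moreover have "(cmod (a - b))\<^sup>2 = a \<bullet> a - 2 * (a \<bullet> b) + \<beta>"
    unfolding dot_square_norm[symmetric] by (simp add: inner_diff inner_commute bb)
  ultimately have "(cmod (a - 1 / cnj b))\<^sup>2 \<le> (cmod (a - b))\<^sup>2" by simp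
  then show ?thesis by (rule power2_le_imp_le) simp
qed

lemma disk_reflection_lipschitz: "1-lipschitz_on UNIV disk_reflection"
proof (rule lipschitz_onI)
  fix a b :: complex
  consider "cmod a \<le> 1" "cmod b \<le> 1" | "cmod a \<le> 1" "1 < cmod b" | "1 < cmod a" "cmod b \<le> 1"
    | "1 < cmod a" "1 < cmod b" by linarith
  then show "dist (disk_reflection a) (disk_reflection b) \<le> 1 * dist a b"
  proof cases
    case 1 then show ?thesis by (simp add: disk_reflection_def)
  next
    case 2
    then show ?thesis using reflected_point_closer[OF 2] by (simp add: disk_reflection_def dist_norm)
  next
    case 3
    then show ?thesis using reflected_point_closer[OF 3(2,1)]
      by (simp add: disk_reflection_def dist_norm norm_minus_commute)
  next
    case 4
    then have "a \<noteq> 0" "b \<noteq> 0" by auto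
    then have "1 / cnj a - 1 / cnj b = cnj (b - a) / cnj (a * b)" by (simp add: field_simps)
    then have "cmod (1 / cnj a - 1 / cnj b) = cmod (a - b) / (cmod a * cmod b)"
      by (simp only: norm_divide complex_mod_cnj norm_mult norm_minus_commute)
    also have "\<dots> \<le> cmod (a - b) / 1"
      using 4 mult_mono[of 1 "cmod a" 1 "cmod b"] by (intro divide_left_mono) auto
    finally show ?thesis using 4 by (simp add: disk_reflection_def dist_norm)
  qed
qed simp

text \<open>Solving \<open>c w + h w = v\<close> is a fixed point problem for the contraction \<open>(v - h w) / c\<close>, and
  the map multiplies distances by at least \<open>|c| - K\<close>, so the inverse is Lipschitz.\<close>

lemma lipschitz_perturbation_homeomorphism:
  assumes h: "K-lipschitz_on UNIV h" and K: "K < cmod c"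
  shows "\<exists>g'. homeomorphism UNIV UNIV (\<lambda>w. c * w + h w) g'"
proof -
  let ?g = "\<lambda>w. c * w + h w"
  have K0: "0 \<le> K" using h by (rule lipschitz_on_nonneg)
  have c: "c \<noteq> 0" "0 < cmod c" using K0 K by auto
  have h': "cmod (h a - h b) \<le> K * cmod (a - b)" for a b
    using lipschitz_onD[OF h, of a b] by (simp add: dist_norm)
  have expand: "(cmod c - K) * cmod (a - b) \<le> cmod (?g a - ?g b)" for a b
  proof -
    have "cmod c * cmod (a - b) = cmod ((?g a - ?g b) - (h a - h b))"
      by (simp add: norm_mult[symmetric] algebra_simps)
    also have "\<dots> \<le> cmod (?g a - ?g b) + cmod (h a - h b)" by (rule norm_triangle_ineq4)
    finally show ?thesis using h'[of a b] by (simp add: algebra_simps)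
  qed
  have surj: "\<exists>w. ?g w = v" for v
  proof -
    have "\<exists>!w\<in>UNIV. (v - h w) / c = w"
    proof (rule Banach_fix)
      show "K / cmod c < 1" "0 \<le> K / cmod c" using K c K0 by auto
      show "dist ((v - h a) / c) ((v - h b) / c) \<le> K / cmod c * dist a b" for a b
      proof -
        have "(v - h a) / c - (v - h b) / c = (h b - h a) / c" by (simp add: diff_divide_distrib)
        then have "dist ((v - h a) / c) ((v - h b) / c) = cmod (h a - h b) / cmod c"
          by (simp add: dist_norm norm_divide norm_minus_commute)
        also have "\<dots> \<le> K * cmod (a - b) / cmod c" using h' by (intro divide_right_mono) auto
        finally show ?thesis by (simp add: dist_norm)
      qed
    qed (auto simp: complete_UNIV)
    then obtain w where "(v - h w) / c = w" by blast
    then show ?thesis using c by (intro exI[of _ w]) (simp add: field_simps)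
  qed
  then obtain g' where g': "\<And>v. ?g (g' v) = v" by metis
  have g'g: "g' (?g w) = w" for w
  proof -
    have "(cmod c - K) * cmod (g' (?g w) - w) \<le> 0" using expand[of "g' (?g w)" w] g'[of "?g w"] by simp
    then have "cmod (g' (?g w) - w) \<le> 0" using K by (simp add: mult_le_0_iff)
    then show ?thesis by simp
  qed
  have "(1 / (cmod c - K))-lipschitz_on UNIV g'"
  proof (rule lipschitz_onI)
    fix a b
    show "dist (g' a) (g' b) \<le> 1 / (cmod c - K) * dist a b"
      using expand[of "g' a" "g' b"] K g' by (simp add: dist_norm field_simps)
  qed (use K in auto)
  then have "continuous_on UNIV g'" by (rule lipschitz_on_continuous_on)
  moreover have "continuous_on UNIV ?g"
    by (intro continuous_intros lipschitz_on_continuous_on[OF h])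
  ultimately have "homeomorphism UNIV UNIV ?g g'"
    using g' g'g by (intro homeomorphismI) auto
  then show ?thesis by blast
qed

lemma lipschitz_on_deriv_bound:
  assumes h: "K-lipschitz_on S h" and "open S" "z \<in> S" and d: "(h has_field_derivative d) (at z)"
  shows "cmod d \<le> K"
proof (rule tendsto_upperbound)
  show "((\<lambda>y. cmod ((h y - h z) / (y - z))) \<longlongrightarrow> cmod d) (at z)"
    using d unfolding has_field_derivative_iff by (rule tendsto_norm)
  have "\<forall>\<^sub>F y in at z. y \<in> S \<and> y \<noteq> z"
    using eventually_at_in_open[OF assms(2,3)] by (simp add: eventually_mono)
  then show "\<forall>\<^sub>F y in at z. cmod ((h y - h z) / (y - z)) \<le> K"
  proof (rule eventually_mono)
    fix y assume y: "y \<in> S \<and> y \<noteq> z"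
    have "cmod (h y - h z) \<le> K * cmod (y - z)"
      using lipschitz_onD[OF h, of y z] y assms(3) by (simp add: dist_norm)
    then show "cmod ((h y - h z) / (y - z)) \<le> K" using y by (simp add: norm_divide divide_le_eq)
  qed
qed auto

text \<open>The extension is \<open>c w + H(R w)\<close>, where \<open>R\<close> is reflection of the exterior into the disk and
  \<open>H\<close> extends \<open>G w - c w\<close> to the closed disk. Outside, the second summand is antiholomorphic, so it
  contributes to the derivative in \<open>cnj w\<close> only, and its size is bounded by the Lipschitz constant of
  \<open>H\<close> because \<open>R\<close> has derivative of modulus \<open>1 / |w|\<^sup>2 \<le> 1\<close>.\<close>

lemma quasiconformal_extension_of_near_linear:
  assumes G: "G holomorphic_on \<D>" and k: "0 \<le> k" "k < 1" and c: "c \<noteq> 0"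
    and lip: "(k * cmod c)-lipschitz_on \<D> (\<lambda>w. G w - c * w)"
  shows "\<exists>g. quasiconformal_automorphism k g \<and> (\<forall>z\<in>\<D>. g z = G z)"
proof -
  define K where "K = k * cmod c"
  have K: "0 \<le> K" "K < cmod c" using k c by (auto simp: K_def)
  obtain H where H: "K-lipschitz_on (cball 0 1) H" and HG: "\<And>w. w \<in> \<D> \<Longrightarrow> H w = G w - c * w"
  proof -
    have "closure \<D> = cball (0::complex) 1" by simp
    with lipschitz_extend_closure[OF lip] that show ?thesis unfolding K_def by metis
  qed
  define g where "g w = c * w + H (disk_reflection w)" for w
  have Hr: "K-lipschitz_on UNIV (\<lambda>w. H (disk_reflection w))"
  proof (rule lipschitz_onI)
    fix a b :: complex
    have "dist (H (disk_reflection a)) (H (disk_reflection b)) \<le> K * dist (disk_reflection a) (disk_reflection b)"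
      by (intro lipschitz_onD[OF H] disk_reflection_in_cball)
    also have "\<dots> \<le> K * dist a b"
      using lipschitz_onD[OF disk_reflection_lipschitz, of a b] K(1) by (intro mult_left_mono) auto
    finally show "dist (H (disk_reflection a)) (H (disk_reflection b)) \<le> K * dist a b" .
  qed (rule K)
  have gG: "g z = G z" if "z \<in> \<D>" for z
    using that HG[OF that] by (simp add: g_def disk_reflection_def)
  have homeo: "\<exists>g'. homeomorphism UNIV UNIV g g'"
    unfolding g_def by (rule lipschitz_perturbation_homeomorphism[OF Hr K(2)])
  define L where "L = cmod c + K"
  have lipg: "L-lipschitz_on UNIV g"
  proof (rule lipschitz_onI)
    fix a b :: complex
    have "g a - g b = c * (a - b) + (H (disk_reflection a) - H (disk_reflection b))"
      by (simp add: g_def algebra_simps)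
    then have "cmod (g a - g b) \<le> cmod c * cmod (a - b) + cmod (H (disk_reflection a) - H (disk_reflection b))"
      by (metis norm_mult norm_triangle_ineq)
    then show "dist (g a) (g b) \<le> L * dist a b"
      using lipschitz_onD[OF Hr, of a b] by (simp add: dist_norm L_def algebra_simps)
  qed (use K in \<open>simp add: L_def\<close>)
  have dG: "(G has_field_derivative deriv G z) (at z)" if "z \<in> \<D>" for z
    by (rule holomorphic_derivI[OF G open_ball that])
  \<comment> \<open>Outside the disk, \<open>H(1 / cnj z)\<close> has derivative \<open>- \<beta> z\<close> with respect to \<open>cnj z\<close>, and
    \<open>d v\<close> is the derivative of \<open>g\<close> in direction \<open>v\<close>; nothing is known on the unit circle, a null set.\<close>
  define \<beta> where "\<beta> z = (deriv G (1 / cnj z) - c) / (cnj z)\<^sup>2" for z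
  define d where "d v z = (if cmod z = 1 then 0 else if cmod z < 1 then v * deriv G z
      else c * v - \<beta> z * cnj v)" for v z
  have \<beta>K: "cmod (\<beta> z) \<le> K" if z: "1 < cmod z" for z
  proof -
    have in_disk: "1 / cnj z \<in> \<D>" using z by (simp add: norm_divide divide_less_eq)
    have "((\<lambda>w. G w - c * w) has_field_derivative deriv G (1 / cnj z) - c) (at (1 / cnj z))"
      by (intro DERIV_diff DERIV_cmult_Id dG in_disk)
    then have "cmod (deriv G (1 / cnj z) - c) \<le> K"
      using lipschitz_on_deriv_bound[OF lip open_ball in_disk] by (simp add: K_def)
    moreover have "1 \<le> (cmod z)\<^sup>2" using z by (simp add: one_le_power)
    ultimately have "cmod (deriv G (1 / cnj z) - c) / (cmod z)\<^sup>2 \<le> K / 1"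
      using K by (intro frac_le) auto
    then show ?thesis by (simp add: \<beta>_def norm_divide norm_power)
  qed
  have deriv_line: "((\<lambda>t. g (z + t *\<^sub>R v)) has_vector_derivative d v z) (at 0)" if z: "z \<notin> sphere 0 1" for z v
  proof (cases "cmod z < 1")
    case True
    then have zD: "z \<in> \<D>" by simp
    have line: "((\<lambda>t. z + t *\<^sub>R v) has_vector_derivative v) (at 0)"
      by (auto intro!: derivative_eq_intros)
    have "(g has_field_derivative deriv G z) (at z)"
      using dG[OF zD] by (rule has_field_derivative_transform_within_open[OF _ open_ball zD]) (rule gG[symmetric])
    then have "((g \<circ> (\<lambda>t. z + t *\<^sub>R v)) has_vector_derivative v * deriv G z) (at 0)"
      by (intro field_vector_diff_chain_at line) simp
    then show ?thesis using True by (simp add: d_def o_def)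
  next
    case False
    then have z1: "1 < cmod z" using z by simp
    have in_disk: "inverse (cnj z) \<in> \<D>" using z1 by (simp add: norm_inverse inverse_less_1_iff)
    have nz: "cnj z \<noteq> 0" using z1 by auto
    let ?h = "\<lambda>w. G w - c * w"
    have line: "((\<lambda>t. z + t *\<^sub>R v) has_vector_derivative v) (at 0)"
      by (auto intro!: derivative_eq_intros)
    then have cline: "((\<lambda>t. cnj (z + t *\<^sub>R v)) has_vector_derivative cnj v) (at 0)"
      by (rule has_vector_derivative_cnj)
    have "(?h has_field_derivative deriv G (inverse (cnj z)) - c) (at (inverse (cnj z)))"
      by (intro DERIV_diff DERIV_cmult_Id dG in_disk)
    then have "((\<lambda>u. ?h (inverse u)) has_field_derivative
        (deriv G (inverse (cnj z)) - c) * - (inverse (cnj z) ^ Suc (Suc 0))) (at (cnj z))"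
      using DERIV_inverse[OF nz] by (rule DERIV_chain2)
    then have "((\<lambda>u. ?h (inverse u)) has_field_derivative - \<beta> z) (at (cnj z))"
      by (simp add: \<beta>_def divide_inverse power2_eq_square)
    then have "((\<lambda>u. ?h (inverse u)) has_field_derivative - \<beta> z) (at (cnj (z + 0 *\<^sub>R v)))" by simp
    from field_vector_diff_chain_at[OF cline this]
    have "((\<lambda>t. ?h (inverse (cnj (z + t *\<^sub>R v)))) has_vector_derivative cnj v * - \<beta> z) (at 0)"
      by (simp only: o_def)
    moreover have "((\<lambda>t. c * (z + t *\<^sub>R v)) has_vector_derivative c * v) (at 0)"
      by (rule has_vector_derivative_mult_right[OF line])
    ultimately have sum: "((\<lambda>t. c * (z + t *\<^sub>R v) + ?h (inverse (cnj (z + t *\<^sub>R v))))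
        has_vector_derivative c * v + cnj v * - \<beta> z) (at 0)"
      by (rule has_vector_derivative_add[rotated])
    have "((\<lambda>t. g (z + t *\<^sub>R v)) has_vector_derivative c * v + cnj v * - \<beta> z) (at 0)"
    proof (rule has_vector_derivative_transform_within_open[OF sum])
      show "open {t. 1 < cmod (z + t *\<^sub>R v)}"
        by (intro open_Collect_less continuous_intros)
      show "0 \<in> {t. 1 < cmod (z + t *\<^sub>R v)}" using z1 by simp
      fix t assume t: "t \<in> {t. 1 < cmod (z + t *\<^sub>R v)}"
      then have "inverse (cnj (z + t *\<^sub>R v)) \<in> \<D>"
        by (simp add: norm_inverse inverse_less_1_iff del: complex_cnj_add)
      from HG[OF this] show "c * (z + t *\<^sub>R v) + ?h (inverse (cnj (z + t *\<^sub>R v))) = g (z + t *\<^sub>R v)"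
        using t by (simp add: g_def disk_reflection_def divide_inverse del: complex_cnj_add)
    qed
    then show ?thesis using z1 by (simp add: d_def mult.commute)
  qed
  have null: "sphere (0::complex) 1 \<in> null_sets lborel"
    using negligible_sphere[of "0::complex" 1] by (simp add: null_sets_completion_iff negligible_iff_null_sets)
  have d0: "d v z = 0" if "z \<in> sphere 0 1" for v z using that by (simp add: d_def)
  have sob: "d v \<in> borel_measurable borel" "cmod (d v z) \<le> L" "weak_derivative v g (d v)"
    if "v = 1 \<or> v = \<i>" for v z
    using lipschitz_weak_derivative[OF lipg that null deriv_line d0] by auto
  have contg: "continuous_on UNIV g" by (rule lipschitz_on_continuous_on[OF lipg])
  have "L2_loc g"
  proof (intro L2_loc_borel borel_measurable_continuous_onI contg)
    fix S :: "complex set" assume "compact S"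
    then obtain B where "\<And>z. z \<in> S \<Longrightarrow> cmod (g z) \<le> B"
      using continuous_on_compact_bound[OF _ continuous_on_subset[OF contg subset_UNIV]] by blast
    then show "\<exists>B. \<forall>z\<in>S. cmod (g z) \<le> B" by blast
  qed
  moreover have "L2_loc (d 1)" "L2_loc (d \<i>)"
    using sob by (auto intro!: L2_loc_borel)
  ultimately have W: "W12_loc g (d 1) (d \<i>)"
    using sob by (simp add: W12_loc_def)
  have "AE z in lebesgue. (z::complex) \<notin> sphere 0 1"
    using negligible_sphere[of "0::complex" 1] by (intro AE_not_in) (simp add: negligible_iff_null_sets)
  then have "AE z in lebesgue. cmod ((d 1 z + \<i> * d \<i> z) / 2) \<le> k * cmod ((d 1 z - \<i> * d \<i> z) / 2)"
  proof (rule AE_mp, intro AE_I2 impI)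
    fix z :: complex assume z: "z \<notin> sphere 0 1"
    show "cmod ((d 1 z + \<i> * d \<i> z) / 2) \<le> k * cmod ((d 1 z - \<i> * d \<i> z) / 2)"
    proof (cases "cmod z < 1")
      case True
      then show ?thesis using k by (simp add: d_def mult.assoc[symmetric])
    next
      case False
      then have z1: "1 < cmod z" using z by simp
      have "(d 1 z + \<i> * d \<i> z) / 2 = - \<beta> z" "(d 1 z - \<i> * d \<i> z) / 2 = c"
        using z1 by (simp_all add: d_def algebra_simps)
      then show ?thesis using \<beta>K[OF z1] by (simp add: K_def)
    qed
  qed
  then have "quasiconformal_automorphism k g"
    unfolding quasiconformal_automorphism_def using k homeo W by blast
  then show ?thesis using gG by blast
qed

section \<open>The bound A and the conclusion\<close>

text \<open>The cubic \<open>y\<^sup>3 - 21 y\<close> takes the value \<open>16\<close> between \<open>4.9\<close> and \<open>5\<close> and increases beyond, so the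
  greatest root of \<open>A(x) = 1\<close> is \<open>1 + y\<close> for that \<open>y\<close>.\<close>

lemma r0_gt: "29 / 5 < r0"
  and A_bound_r0: "A_bound r0 = 1"
proof -
  define p :: "real \<Rightarrow> real" where "p y = y ^ 3 - 21 * y" for y
  have "\<exists>y\<ge>49/10. y \<le> 5 \<and> p y = 16"
    by (rule IVT') (auto simp: p_def power3_eq_cube intro!: continuous_intros)
  then obtain y where y: "49/10 \<le> y" "y \<le> 5" "p y = 16" by blast
  have "r0 = 1 + y"
    unfolding r0_def
  proof (rule Greatest_equality)
    show "A_bound (1 + y) = 1" using y(3) by (simp add: A_bound_eq_1_iff p_def)
  next
    fix x assume "A_bound x = 1"
    then have px: "p (x - 1) = 16" by (simp add: A_bound_eq_1_iff p_def)
    show "x \<le> 1 + y"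
    proof (rule ccontr)
      define u where "u = x - 1"
      assume "\<not> x \<le> 1 + y"
      then have u: "y < u" by (simp add: u_def)
      have "49/10 * (49/10) \<le> y * y" using y(1) by (intro mult_mono) auto
      moreover have "0 \<le> u * y" "0 \<le> u * u" using u y(1) by auto
      ultimately have "0 < u\<^sup>2 + u * y + y\<^sup>2 - 21" unfolding power2_eq_square by linarith
      then have "0 < (u - y) * (u\<^sup>2 + u * y + y\<^sup>2 - 21)" using u by simp
      also have "\<dots> = p u - p y" by (simp add: p_def power2_eq_square power3_eq_cube algebra_simps)
      finally show False using px y(3) by (simp add: u_def)
    qed
  qed
  moreover have "A_bound (1 + y) = 1" using y(3) by (simp add: A_bound_eq_1_iff p_def)
  ultimately show "29 / 5 < r0" "A_bound r0 = 1" using y(1) by simp_all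
qed

lemma A_bound_factored: "A_bound x = 6 * x * (1 + x) / ((x - 2) * (x\<^sup>2 + 5 * x - 2))"
proof -
  have "(1 + x) ^ 3 - 3 * (5 * x - 1) = (x - 2) * (x\<^sup>2 + 5 * x - 2)"
    by (simp add: power2_eq_square power3_eq_cube algebra_simps)
  then show ?thesis by (simp add: A_bound_def)
qed

text \<open>Beyond \<open>r0\<close> the cubic \<open>(x - 1)\<^sup>3 - 21 (x - 1)\<close> exceeds \<open>16\<close>, that is, the denominator of \<open>A\<close>
  exceeds the numerator. The last claim amounts to \<open>x (x - 2) (x - 5) \<ge> 12\<close>; the factor \<open>x - 2\<close>
  in the denominator of \<open>A\<close> cancels one of the two on the left.\<close>

lemma A_bound_estimates:
  assumes x: "r0 < x"
  shows "0 < A_bound x" and "A_bound x < 1"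
    and "2 * x * (2 * x - 3) / (x - 2)\<^sup>2 \<le> A_bound x * (1 + x)"
proof -
  have x': "29 / 5 < x" using x r0_gt by simp
  have d: "0 < x - 2" "0 < x\<^sup>2 + 5 * x - 2" using x' zero_le_power2[of x] by linarith+
  show "0 < A_bound x" using d x' unfolding A_bound_factored by simp
  show "A_bound x < 1"
  proof -
    define y where "y = r0 - 1"
    define u where "u = x - 1"
    have u: "y < u" "4 < y" using x r0_gt by (auto simp: y_def u_def)
    have y: "y ^ 3 - 21 * y = 16" using A_bound_r0 by (simp add: A_bound_eq_1_iff y_def)
    have "24/5 < y" using r0_gt by (simp add: y_def)
    then have "24/5 * (24/5) \<le> y * y" by (intro mult_mono) auto
    moreover have "0 \<le> u * y" "0 \<le> u * u" using u by auto
    ultimately have "0 < u\<^sup>2 + u * y + y\<^sup>2 - 21" unfolding power2_eq_square by linarith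
    then have "0 < (u - y) * (u\<^sup>2 + u * y + y\<^sup>2 - 21)" using u by simp
    also have "\<dots> = (u ^ 3 - 21 * u) - (y ^ 3 - 21 * y)" by (simp add: power2_eq_square power3_eq_cube algebra_simps)
    finally have "16 < u ^ 3 - 21 * u" using y by simp
    then have "6 * x * (1 + x) < (x - 2) * (x\<^sup>2 + 5 * x - 2)"
      by (simp add: u_def power2_eq_square power3_eq_cube algebra_simps)
    then show ?thesis using d unfolding A_bound_factored by simp
  qed
  show "2 * x * (2 * x - 3) / (x - 2)\<^sup>2 \<le> A_bound x * (1 + x)"
  proof -
    have "29/5 * (19/5) * (4/5) \<le> x * (x - 2) * (x - 5)" using x' by (intro mult_mono) auto
    then have "0 \<le> x * (x - 2) * (x - 5) - 12" by simp
    then have "(2 * x - 3) * (x\<^sup>2 + 5 * x - 2) \<le> 3 * (1 + x)\<^sup>2 * (x - 2)"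
      by (simp add: power2_eq_square algebra_simps)
    then have "2 * x * (x - 2) * ((2 * x - 3) * (x\<^sup>2 + 5 * x - 2)) \<le> 2 * x * (x - 2) * (3 * (1 + x)\<^sup>2 * (x - 2))"
      using x' by (intro mult_left_mono) auto
    moreover have "2 * x * (x - 2) * ((2 * x - 3) * (x\<^sup>2 + 5 * x - 2)) = 2 * x * (2 * x - 3) * ((x - 2) * (x\<^sup>2 + 5 * x - 2))"
      by (simp only: mult_ac)
    moreover have "2 * x * (x - 2) * (3 * (1 + x)\<^sup>2 * (x - 2)) = 6 * x * (1 + x) * (1 + x) * (x - 2)\<^sup>2"
      by (simp add: power2_eq_square)
    ultimately have "2 * x * (2 * x - 3) * ((x - 2) * (x\<^sup>2 + 5 * x - 2)) \<le> 6 * x * (1 + x) * (1 + x) * (x - 2)\<^sup>2"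
      by (simp only:)
    then show ?thesis using d unfolding A_bound_factored by (simp add: divide_simps mult_ac)
  qed
qed

lemma the_inv_into_unique_solution:
  assumes "\<exists>z\<in>S. F z = w" and "\<And>z z'. z \<in> S \<Longrightarrow> z' \<in> S \<Longrightarrow> F z = w \<Longrightarrow> F z' = w \<Longrightarrow> z = z'"
  shows "the_inv_into S F w \<in> S \<and> F (the_inv_into S F w) = w"
  unfolding the_inv_into_def by (rule theI') (use assms in blast)

theorem corollary4p3:
  fixes q :: complex and r :: real and G :: "complex \<Rightarrow> complex"
  assumes "Re q > 0"
    and "r > 0"
    and "G \<in> resolvent_family q r"
    and "r * Re q > r0"
  shows "\<exists>g. quasiconformal_automorphism (A_bound (r * Re q)) g \<and> (\<forall>z\<in>\<D>. g z = G z)"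
proof -
  define x where "x = r * Re q"
  have x: "r0 < x" using assms(4) by (simp add: x_def)
  have x2: "2 < x" using x r0_gt by simp
  obtain f where f: "generator f" "f 0 = 0" "deriv f 0 = q" and G: "G = nonlinear_resolvent r f"
    using assms(3) unfolding resolvent_family_def by blast
  have hol: "f holomorphic_on \<D>" using f(1) by (simp add: generator_def)
  define p where "p z = (if z = 0 then q else f z / z)" for z
  have fp: "f z = z * p z" for z by (simp add: p_def f(2))
  have p: "p holomorphic_on \<D>"
    by (rule pole_theorem_open_0[OF hol open_ball, of 0]) (auto simp: p_def f)
  define P where "P z = of_real r * p z" for z
  have P: "P holomorphic_on \<D>" unfolding P_def by (intro holomorphic_intros p)
  have ReP0: "Re (P 0) = x" by (simp add: P_def p_def x_def)
  have "0 \<le> Re (P z)" if z: "z \<in> \<D>" for z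
  proof (cases "z = 0")
    case True then show ?thesis using ReP0 x2 by simp
  next
    case False
    have "z \<bullet> f z = (cmod z)\<^sup>2 * Re (p z)"
      unfolding fp cmod_power2 by (simp add: inner_complex_def power2_eq_square algebra_simps)
    then have "0 \<le> Re (p z)"
      using generator_inner_nonneg[OF f(1,2) z] False by (simp add: zero_le_mult_iff)
    then show ?thesis using assms(2) by (simp add: P_def)
  qed
  then have pos: "0 < Re (P z)" if "z \<in> \<D>" for z
    using Re_pos_of_nonneg[OF P _ _ that] ReP0 x2 by simp
  have F: "(\<lambda>z. z + of_real r * f z) = (\<lambda>z. z * (1 + P z))"
    by (auto simp: fp P_def algebra_simps)
  have inj: "inj_on (\<lambda>z. z * (1 + P z)) (ball 0 (1 / (x - 1)))"
    using inverse_close_to_linear(1)[OF P _ ReP0[symmetric] x2 A_bound_estimates(2,3)[OF x]] pos by blast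
  have sol: "G w \<in> \<D> \<and> G w * (1 + P (G w)) = w" if w: "w \<in> \<D>" for w
    unfolding G nonlinear_resolvent_def F
  proof (rule the_inv_into_unique_solution)
    show "\<exists>z\<in>\<D>. z * (1 + P z) = w" by (rule equation_solvable[OF P pos w])
    fix z z' assume z: "z \<in> \<D>" "z' \<in> \<D>" "z * (1 + P z) = w" "z' * (1 + P z') = w"
    have "v \<in> ball 0 (1 / (x - 1))" if "v \<in> \<D>" "v * (1 + P v) = w" for v
      using solution_small[OF P pos _ that(1)] that(2) w ReP0 x2 by simp
    then show "z = z'" using z inj_onD[OF inj] by metis
  qed
  obtain c where "G holomorphic_on \<D>" "c \<noteq> 0" "(A_bound x * cmod c)-lipschitz_on \<D> (\<lambda>w. G w - c * w)"
    using inverse_close_to_linear(2)[OF P _ ReP0[symmetric] x2 A_bound_estimates(2,3)[OF x], of G] pos sol by blast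
  then show ?thesis
    using quasiconformal_extension_of_near_linear A_bound_estimates[OF x] unfolding x_def
    by (meson less_imp_le)
qed

end
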